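(* Let $\lambda_1,\lambda_2,\lambda_3,\lambda_4\in\mathbb R$, and let $G$ be a connected 4-dimensional Lie group whose Lie algebra has a basis of left-invariant vector fields $\{X_1,X_2,X_3,X_4\}$ with $$\begin{array}{ll}[X_1,X_3]=\lambda_2X_2+\lambda_4X_4,&[X_2,X_4]=\lambda_1X_1+\lambda_3X_3,\\ {}[X_2,X_3]=-\lambda_2X_1-\lambda_3X_4,&[X_3,X_4]=-\lambda_4X_1+\lambda_3X_2,\\ {}[X_4,X_1]=\lambda_1X_2+\lambda_4X_3,&[X_2,X_1]=-\lambda_2X_3+\lambda_1X_4.\end{array}$$ Let $J$ be the left-invariant almost complex structure with $JX_1=X_3$, $JX_2=X_4$, $JX_3=-X_1$, $JX_4=-X_2$, let $g$ be the left-invariant metric with $g(X_1,X_1)=g(X_2,X_2)=-g(X_3,X_3)=-g(X_4,X_4)=1$ and $g(X_i,X_j)=0$ for $i\ne j$, and let $\tilde g(X,Y)=g(X,JY)$. Then $(G,J,\tilde g)$ is an isotropic Kähler manifold with Norden metric if and only if $\lambda_1\lambda_3+\lambda_2\lambda_4=0$.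
   Context: A Norden metric on an almost complex manifold $(M,J)$ (with $J^2=-\mathrm{id}$) is a pseudo-Riemannian metric $h$ such that $h(JX,JY)=-h(X,Y)$ for all vector fields $X,Y$; $g$ and $\tilde g$ are both Norden metrics on $(G,J)$. Let $\tilde\nabla$ be the Levi-Civita connection of $\tilde g$, and let $\tilde g^{ij}$ be the entries of the inverse of the matrix $(\tilde g(e_i,e_j))$ in a basis $\{e_i\}$ of a tangent space. The square norm of $\tilde\nabla J$ with respect to $\tilde g$ is $$\|\tilde\nabla J\|^2=\tilde g^{ij}\tilde g^{kl}\,\tilde g\bigl((\tilde\nabla_{e_i}J)e_k,(\tilde\nabla_{e_j}J)e_l\bigr)$$ (summation over repeated indices). The manifold $(G,J,\tilde g)$ is called an isotropic Kähler manifold with Norden metric if $\|\tilde\nabla J\|^2=0$. *)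

theory Defs
  imports "HOL-Analysis.Analysis" "HOL-Algebra.Group" "HOL-Library.Function_Algebras"
begin

section \<open>Functions as a real vector space\<close>

instantiation "fun" :: (type, real_vector) real_vector
begin

definition scaleR_fun :: "real \<Rightarrow> ('a \<Rightarrow> 'b) \<Rightarrow> 'a \<Rightarrow> 'b" where
  "scaleR_fun r f = (\<lambda>x. r *\<^sub>R f x)"

instance
  by standard (auto simp: scaleR_fun_def fun_eq_iff scaleR_add_right scaleR_add_left)

end

lemma scaleR_fun_apply [simp]: "(r *\<^sub>R f) x = r *\<^sub>R f x"
  by (simp add: scaleR_fun_def)

definition basis_of :: "'v::real_vector set \<Rightarrow> ('i \<Rightarrow> 'v) \<Rightarrow> bool" where
  "basis_of S e \<longleftrightarrow> inj e \<and> independent (range e) \<and> span (range e) = S"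


section \<open>Smooth manifolds\<close>

text \<open>\<open>Ck k S f\<close> is meant for open \<open>S\<close>: all partial derivatives up to order \<open>k\<close> exist
  on \<open>S\<close> and are continuous there.\<close>

primrec Ck :: "nat \<Rightarrow> 'e::euclidean_space set \<Rightarrow> ('e \<Rightarrow> 'f::real_normed_vector) \<Rightarrow> bool" where
  "Ck 0 S f \<longleftrightarrow> continuous_on S f"
| "Ck (Suc k) S f \<longleftrightarrow> (\<forall>x\<in>S. f differentiable (at x)) \<and>
     (\<forall>v. Ck k S (\<lambda>x. frechet_derivative f (at x) v))"

definition smooth_on :: "'e::euclidean_space set \<Rightarrow> ('e \<Rightarrow> 'f::real_normed_vector) \<Rightarrow> bool" where
  "smooth_on S f \<longleftrightarrow> (\<forall>k. Ck k S f)"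

text \<open>A chart is a pair of its domain and its coordinate map; the values of the coordinate map
  outside the domain are irrelevant.\<close>

type_synonym ('a, 'e) chart = "'a set \<times> ('a \<Rightarrow> 'e)"

definition is_chart :: "('a::topological_space, 'e::euclidean_space) chart \<Rightarrow> bool" where
  "is_chart c \<longleftrightarrow> open (fst c) \<and> open (snd c ` fst c) \<and>
     homeomorphism (fst c) (snd c ` fst c) (snd c) (inv_into (fst c) (snd c))"

definition local_rep :: "('a, 'e) chart \<Rightarrow> ('b, 'f) chart \<Rightarrow> ('a \<Rightarrow> 'b) \<Rightarrow> 'e \<Rightarrow> 'f" where
  "local_rep c d f = snd d \<circ> f \<circ> inv_into (fst c) (snd c)"

definition smooth_atlas ::
  "('a::{t2_space,second_countable_topology}, 'e::euclidean_space) chart set \<Rightarrow> bool" where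
  "smooth_atlas A \<longleftrightarrow> (\<forall>c\<in>A. is_chart c) \<and> (\<Union>c\<in>A. fst c) = UNIV \<and>
     (\<forall>c\<in>A. \<forall>d\<in>A. smooth_on (snd c ` (fst c \<inter> fst d)) (local_rep c d id))"

definition smooth_map ::
  "('a::topological_space, 'e::euclidean_space) chart set \<Rightarrow>
   ('b::topological_space, 'f::euclidean_space) chart set \<Rightarrow> ('a \<Rightarrow> 'b) \<Rightarrow> bool" where
  "smooth_map A B f \<longleftrightarrow> continuous_on UNIV f \<and>
     (\<forall>c\<in>A. \<forall>d\<in>B. smooth_on (snd c ` (fst c \<inter> f -` fst d)) (local_rep c d f))"

definition smooth_fun :: "('a, 'e::euclidean_space) chart set \<Rightarrow> ('a \<Rightarrow> real) \<Rightarrow> bool" where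
  "smooth_fun A f \<longleftrightarrow>
     (\<forall>c\<in>A. smooth_on (snd c ` fst c) (f \<circ> inv_into (fst c) (snd c)))"

definition prod_atlas ::
  "('a, 'e) chart set \<Rightarrow> ('b, 'f) chart set \<Rightarrow> ('a \<times> 'b, 'e \<times> 'f) chart set" where
  "prod_atlas A B = {(fst c \<times> fst d, map_prod (snd c) (snd d)) | c d. c \<in> A \<and> d \<in> B}"


section \<open>Tangent vectors and vector fields\<close>

definition charts_at :: "('a, 'e) chart set \<Rightarrow> 'a \<Rightarrow> ('a, 'e) chart set" where
  "charts_at A p = {c \<in> A. p \<in> fst c}"

definition chart_at :: "('a, 'e) chart set \<Rightarrow> 'a \<Rightarrow> ('a, 'e) chart" where
  "chart_at A p = (SOME c. c \<in> charts_at A p)"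

text \<open>A tangent vector at \<open>p\<close> is the family of its coordinate vectors in all charts around
  \<open>p\<close>, related by the Jacobians of the coordinate changes. It is set to 0 on all other pairs, so
  that equality of tangent vectors is equality of functions.\<close>

type_synonym ('a, 'e) tvec = "('a, 'e) chart \<Rightarrow> 'e"

type_synonym ('a, 'e) vfield = "'a \<Rightarrow> ('a, 'e) tvec"

definition tangent_space ::
  "('a, 'e::euclidean_space) chart set \<Rightarrow> 'a \<Rightarrow> ('a, 'e) tvec set" where
  "tangent_space A p = {v. (\<forall>c. c \<notin> charts_at A p \<longrightarrow> v c = 0) \<and>
     (\<forall>c\<in>charts_at A p. \<forall>d\<in>charts_at A p.
        v d = frechet_derivative (local_rep c d id) (at (snd c p)) (v c))}"

definition field_rep :: "('a, 'e) vfield \<Rightarrow> ('a, 'e) chart \<Rightarrow> 'e \<Rightarrow> 'e" where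
  "field_rep X c = (\<lambda>x. X (inv_into (fst c) (snd c) x) c)"

definition vector_field ::
  "('a, 'e::euclidean_space) chart set \<Rightarrow> ('a, 'e) vfield \<Rightarrow> bool" where
  "vector_field A X \<longleftrightarrow> (\<forall>p. X p \<in> tangent_space A p) \<and>
     (\<forall>c\<in>A. smooth_on (snd c ` fst c) (field_rep X c))"

text \<open>The choices made by \<open>chart_at\<close> below and in \<open>dir_deriv\<close> are immaterial by the chain rule.\<close>

definition differential ::
  "('a, 'e::euclidean_space) chart set \<Rightarrow> ('b, 'f::euclidean_space) chart set \<Rightarrow>
   ('a \<Rightarrow> 'b) \<Rightarrow> 'a \<Rightarrow> ('a, 'e) tvec \<Rightarrow> ('b, 'f) tvec" where
  "differential A B f p v = (\<lambda>d. if d \<in> charts_at B (f p)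
     then frechet_derivative (local_rep (chart_at A p) d f) (at (snd (chart_at A p) p))
            (v (chart_at A p))
     else 0)"

definition dir_deriv ::
  "('a, 'e::euclidean_space) chart set \<Rightarrow> ('a, 'e) vfield \<Rightarrow> ('a \<Rightarrow> real) \<Rightarrow> 'a \<Rightarrow> real" where
  "dir_deriv A X f p = (let c = chart_at A p in
     frechet_derivative (f \<circ> inv_into (fst c) (snd c)) (at (snd c p)) (X p c))"

text \<open>In every chart, \<open>[X,Y] = DY(X) - DX(Y)\<close>, that is, \<open>[X,Y] f = X (Y f) - Y (X f)\<close>.\<close>

definition lie_bracket ::
  "('a, 'e::euclidean_space) chart set \<Rightarrow> ('a, 'e) vfield \<Rightarrow> ('a, 'e) vfield \<Rightarrow> ('a, 'e) vfield" where
  "lie_bracket A X Y = (\<lambda>p c. if c \<in> charts_at A p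
     then frechet_derivative (field_rep Y c) (at (snd c p)) (X p c)
        - frechet_derivative (field_rep X c) (at (snd c p)) (Y p c)
     else 0)"


section \<open>Metrics, connections and almost complex structures\<close>

text \<open>Tensors are families of maps on tangent vectors, constrained only on the tangent spaces.\<close>

type_synonym ('a, 'e) bilin_field = "'a \<Rightarrow> ('a, 'e) tvec \<Rightarrow> ('a, 'e) tvec \<Rightarrow> real"

type_synonym ('a, 'e) endo_field = "'a \<Rightarrow> ('a, 'e) tvec \<Rightarrow> ('a, 'e) tvec"

type_synonym ('a, 'e) connection = "('a, 'e) vfield \<Rightarrow> ('a, 'e) vfield \<Rightarrow> ('a, 'e) vfield"

definition pseudo_riemannian ::
  "('a, 'e::euclidean_space) chart set \<Rightarrow> ('a, 'e) bilin_field \<Rightarrow> bool" where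
  "pseudo_riemannian A h \<longleftrightarrow>
     (\<forall>p. \<forall>u\<in>tangent_space A p. \<forall>v\<in>tangent_space A p. h p u v = h p v u) \<and>
     (\<forall>p. \<forall>u\<in>tangent_space A p. \<forall>v\<in>tangent_space A p. \<forall>w\<in>tangent_space A p.
        h p (u + v) w = h p u w + h p v w) \<and>
     (\<forall>p. \<forall>u\<in>tangent_space A p. \<forall>v\<in>tangent_space A p. \<forall>r.
        h p (r *\<^sub>R u) v = r * h p u v) \<and>
     (\<forall>p. \<forall>u\<in>tangent_space A p. (\<forall>v\<in>tangent_space A p. h p u v = 0) \<longrightarrow> u = 0) \<and>
     (\<forall>X Y. vector_field A X \<and> vector_field A Y \<longrightarrow> smooth_fun A (\<lambda>p. h p (X p) (Y p)))"

definition almost_complex ::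
  "('a, 'e::euclidean_space) chart set \<Rightarrow> ('a, 'e) endo_field \<Rightarrow> bool" where
  "almost_complex A J \<longleftrightarrow>
     (\<forall>p. \<forall>u\<in>tangent_space A p. J p u \<in> tangent_space A p) \<and>
     (\<forall>p. \<forall>u\<in>tangent_space A p. \<forall>v\<in>tangent_space A p. J p (u + v) = J p u + J p v) \<and>
     (\<forall>p. \<forall>u\<in>tangent_space A p. \<forall>r. J p (r *\<^sub>R u) = r *\<^sub>R J p u) \<and>
     (\<forall>p. \<forall>u\<in>tangent_space A p. J p (J p u) = - u) \<and>
     (\<forall>X. vector_field A X \<longrightarrow> vector_field A (\<lambda>p. J p (X p)))"

definition norden_metric ::
  "('a, 'e::euclidean_space) chart set \<Rightarrow> ('a, 'e) endo_field \<Rightarrow> ('a, 'e) bilin_field \<Rightarrow> bool" where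
  "norden_metric A J h \<longleftrightarrow> pseudo_riemannian A h \<and>
     (\<forall>p. \<forall>u\<in>tangent_space A p. \<forall>v\<in>tangent_space A p. h p (J p u) (J p v) = - h p u v)"

definition affine_connection ::
  "('a, 'e::euclidean_space) chart set \<Rightarrow> ('a, 'e) connection \<Rightarrow> bool" where
  "affine_connection A D \<longleftrightarrow>
     (\<forall>X Y. vector_field A X \<and> vector_field A Y \<longrightarrow> vector_field A (D X Y)) \<and>
     (\<forall>X X' Y. vector_field A X \<and> vector_field A X' \<and> vector_field A Y \<longrightarrow>
        D (X + X') Y = D X Y + D X' Y) \<and>
     (\<forall>f X Y. smooth_fun A f \<and> vector_field A X \<and> vector_field A Y \<longrightarrow>
        D (\<lambda>p. f p *\<^sub>R X p) Y = (\<lambda>p. f p *\<^sub>R D X Y p)) \<and>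
     (\<forall>X Y Y'. vector_field A X \<and> vector_field A Y \<and> vector_field A Y' \<longrightarrow>
        D X (Y + Y') = D X Y + D X Y') \<and>
     (\<forall>f X Y. smooth_fun A f \<and> vector_field A X \<and> vector_field A Y \<longrightarrow>
        D X (\<lambda>p. f p *\<^sub>R Y p) = (\<lambda>p. dir_deriv A X f p *\<^sub>R Y p + f p *\<^sub>R D X Y p))"

definition levi_civita ::
  "('a, 'e::euclidean_space) chart set \<Rightarrow> ('a, 'e) bilin_field \<Rightarrow> ('a, 'e) connection \<Rightarrow> bool" where
  "levi_civita A h D \<longleftrightarrow> affine_connection A D \<and>
     (\<forall>X Y. vector_field A X \<and> vector_field A Y \<longrightarrow> D X Y - D Y X = lie_bracket A X Y) \<and>
     (\<forall>X Y Z p. vector_field A X \<and> vector_field A Y \<and> vector_field A Z \<longrightarrow>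
        dir_deriv A X (\<lambda>q. h q (Y q) (Z q)) p = h p (D X Y p) (Z p) + h p (Y p) (D X Z p))"

definition cov_deriv_endo ::
  "('a, 'e) connection \<Rightarrow> ('a, 'e::euclidean_space) endo_field \<Rightarrow> ('a, 'e) connection" where
  "cov_deriv_endo D J X Y = (\<lambda>p. D X (\<lambda>q. J q (Y q)) p - J p (D X Y p))"

text \<open>\<open>(D\<^sub>u J) v\<close> for tangent vectors \<open>u\<close>, \<open>v\<close> at \<open>p\<close>. By tensoriality, the choice of the
  vector fields extending \<open>u\<close> and \<open>v\<close> is immaterial.\<close>

definition extension ::
  "('a, 'e::euclidean_space) chart set \<Rightarrow> 'a \<Rightarrow> ('a, 'e) tvec \<Rightarrow> ('a, 'e) vfield" where
  "extension A p v = (SOME X. vector_field A X \<and> X p = v)"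

definition cov_deriv_endo_at ::
  "('a, 'e::euclidean_space) chart set \<Rightarrow> ('a, 'e) connection \<Rightarrow> ('a, 'e) endo_field \<Rightarrow>
   'a \<Rightarrow> ('a, 'e) tvec \<Rightarrow> ('a, 'e) tvec \<Rightarrow> ('a, 'e) tvec" where
  "cov_deriv_endo_at A D J p u v = cov_deriv_endo D J (extension A p u) (extension A p v) p"

definition inverse_gram ::
  "('a, 'e) bilin_field \<Rightarrow> 'a \<Rightarrow> ('i::finite \<Rightarrow> ('a, 'e) tvec) \<Rightarrow> real^'i^'i" where
  "inverse_gram h p e = matrix_inv (\<chi> i j. h p (e i) (e j))"

definition square_norm_nabla_J ::
  "('a, 'e::euclidean_space) chart set \<Rightarrow> ('a, 'e) endo_field \<Rightarrow> ('a, 'e) bilin_field \<Rightarrow>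
   ('a, 'e) connection \<Rightarrow> 'a \<Rightarrow> ('i::finite \<Rightarrow> ('a, 'e) tvec) \<Rightarrow> real" where
  "square_norm_nabla_J A J h D p e =
     (\<Sum>i\<in>UNIV. \<Sum>j\<in>UNIV. \<Sum>k\<in>UNIV. \<Sum>l\<in>UNIV.
        inverse_gram h p e $ i $ j * inverse_gram h p e $ k $ l *
        h p (cov_deriv_endo_at A D J p (e i) (e k)) (cov_deriv_endo_at A D J p (e j) (e l)))"

text \<open>\<open>D\<close> is the Levi-Civita connection of \<open>h\<close>, which is unique on vector fields. The square
  norm does not depend on the basis \<open>e\<close> of the tangent space.\<close>

definition isotropic_kaehler_norden ::
  "('a, real^'n) chart set \<Rightarrow> ('a, real^'n) endo_field \<Rightarrow>
   ('a, real^'n) bilin_field \<Rightarrow> ('a, real^'n) connection \<Rightarrow> bool" where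
  "isotropic_kaehler_norden A J h D \<longleftrightarrow>
     almost_complex A J \<and> norden_metric A J h \<and> levi_civita A h D \<and>
     (\<forall>p. \<forall>e :: 'n \<Rightarrow> ('a, real^'n) tvec. basis_of (tangent_space A p) e \<longrightarrow>
        square_norm_nabla_J A J h D p e = 0)"


section \<open>Lie groups\<close>

definition lie_group ::
  "'a::{t2_space,second_countable_topology} monoid \<Rightarrow> ('a, 'e::euclidean_space) chart set \<Rightarrow> bool"
where
  "lie_group G A \<longleftrightarrow> group G \<and> carrier G = UNIV \<and> smooth_atlas A \<and>
     smooth_map (prod_atlas A A) A (\<lambda>(x, y). x \<otimes>\<^bsub>G\<^esub> y) \<and> smooth_map A A (m_inv G)"

definition left_translation ::
  "'a monoid \<Rightarrow> ('a, 'e::euclidean_space) chart set \<Rightarrow> 'a \<Rightarrow> 'a \<Rightarrow> ('a, 'e) tvec \<Rightarrow> ('a, 'e) tvec"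
where
  "left_translation G A a p = differential A A (\<lambda>x. a \<otimes>\<^bsub>G\<^esub> x) p"

text \<open>The underlying vector space of the Lie algebra of \<open>G\<close>.\<close>

definition left_invariant_fields ::
  "'a monoid \<Rightarrow> ('a, 'e::euclidean_space) chart set \<Rightarrow> ('a, 'e) vfield set" where
  "left_invariant_fields G A = {X. vector_field A X \<and>
     (\<forall>a p. X (a \<otimes>\<^bsub>G\<^esub> p) = left_translation G A a p (X p))}"

definition left_invariant_endo ::
  "'a monoid \<Rightarrow> ('a, 'e::euclidean_space) chart set \<Rightarrow> ('a, 'e) endo_field \<Rightarrow> bool" where
  "left_invariant_endo G A J \<longleftrightarrow> (\<forall>a p. \<forall>u\<in>tangent_space A p.
     J (a \<otimes>\<^bsub>G\<^esub> p) (left_translation G A a p u) = left_translation G A a p (J p u))"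

definition left_invariant_metric ::
  "'a monoid \<Rightarrow> ('a, 'e::euclidean_space) chart set \<Rightarrow> ('a, 'e) bilin_field \<Rightarrow> bool" where
  "left_invariant_metric G A h \<longleftrightarrow> pseudo_riemannian A h \<and>
     (\<forall>a p. \<forall>u\<in>tangent_space A p. \<forall>v\<in>tangent_space A p.
        h (a \<otimes>\<^bsub>G\<^esub> p) (left_translation G A a p u) (left_translation G A a p v) = h p u v)"

end

(* The frame X is g-orthogonal with constant norms, so every vector field is a combination of the
   X_i whose coefficients are, up to constants, the smooth functions g(U, X_i). Hence the tensor
   (D_U J) V is determined by its values N_ij = (D_{X_i} J) X_j on the frame, and the contraction
   defining the square norm may be computed in the frame instead of an arbitrary basis. As
   gt(X_i, X_j) is constant, Koszul's formula expresses D_{X_i} X_j, and thus N_ij, by the structure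
   constants of the Lie algebra; summing up gives the square norm -8 (l1 l3 + l2 l4). *)

theory Submission
  imports Defs
begin

section \<open>Smooth maps and vector fields\<close>

text \<open>The connection acts on globally defined fields only, and the square norm evaluates (D_u
  J) v through unspecified extensions of u and v. Pointwise dependence is usually proved with cutoff
  functions; a global frame avoids them, since constant coefficients extend any vector and smooth
  global coefficients expand any field. The frame is orthogonal for \<open>g\<close> but not for
  \<open>gt\<close>: \<open>gt(X_i, X_j)\<close> is -1 if the indices are partners under 1 <-> 3, 2
  <-> 4, and 0 otherwise. So coordinates are read off with \<open>g\<close>, while contractions with
  \<open>gt\<close>, whose matrix is its own inverse, pair each index with its partner. Three such
  pairings, two from the contractions and one from expanding \<open>gt\<close> itself, put the
  factor (-1)^3 in front of 8 (l1 l3 + l2 l4). The value is the same at all points and for all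
  bases, so its vanishing everywhere is a single equation in the parameters.\<close>

lemma Ck_cong:
  assumes "open S" "\<And>x. x \<in> S \<Longrightarrow> f x = g x"
  shows "Ck k S f \<longleftrightarrow> Ck k S g"
  using assms(2)
proof (induction k arbitrary: f g)
  case 0
  then show ?case by (auto intro: continuous_on_cong)
next
  case (Suc k)
  have diff: "f differentiable (at x) \<longleftrightarrow> g differentiable (at x)" if "x \<in> S" for x
    unfolding differentiable_def
    using has_derivative_transform_within_open[OF _ \<open>open S\<close> that] Suc.prems by metis
  \<comment> \<open>\<open>frechet_derivative\<close> is a choice among the derivatives at
    \<open>x\<close>; \<open>f\<close> and \<open>g\<close> have the same ones, so the choices
    agree.\<close>
  have "frechet_derivative f (at x) = frechet_derivative g (at x)" if "x \<in> S" for x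
    unfolding frechet_derivative_def
    using has_derivative_transform_within_open[OF _ \<open>open S\<close> that] Suc.prems by metis
  then have "Ck k S (\<lambda>x. frechet_derivative f (at x) v) \<longleftrightarrow>
      Ck k S (\<lambda>x. frechet_derivative g (at x) v)" for v
    by (intro Suc.IH) simp
  with diff show ?case by auto
qed

text \<open>Differentiability gives continuity, the only content of order 0. The product rule relies
  on this, as it leaves one factor undifferentiated and must lower its order.\<close>

lemma Ck_SucD: "Ck (Suc k) S f \<Longrightarrow> Ck k S f"
proof (induction k arbitrary: f)
  case 0
  then show ?case
    by (auto intro!: continuous_at_imp_continuous_on differentiable_imp_continuous_within)
next
  case (Suc k)
  from Suc.prems have "f differentiable (at x)" if "x \<in> S" for x
    using that by simp
  moreover from Suc.prems have "Ck k S (\<lambda>x. frechet_derivative f (at x) v)" for v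
    using Suc.IH by simp
  ultimately show ?case by simp
qed

lemma Ck_add:
  assumes "open S" "Ck k S f" "Ck k S g"
  shows "Ck k S (\<lambda>x. f x + g x)"
  using assms(2-)
proof (induction k arbitrary: f g)
  case 0
  then show ?case by (auto intro: continuous_on_add)
next
  case (Suc k)
  have deriv: "frechet_derivative (\<lambda>x. f x + g x) (at x) v =
      frechet_derivative f (at x) v + frechet_derivative g (at x) v" if "x \<in> S" for x v
  proof -
    have "f differentiable (at x)" "g differentiable (at x)"
      using Suc.prems that by auto
    then show ?thesis
      by (subst frechet_derivative_at[symmetric, OF has_derivative_add])
         (auto simp: frechet_derivative_works)
  qed
  have "Ck k S (\<lambda>x. frechet_derivative f (at x) v + frechet_derivative g (at x) v)" for v
    using Suc by auto
  with deriv have "Ck k S (\<lambda>x. frechet_derivative (\<lambda>x. f x + g x) (at x) v)" for v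
    by (subst Ck_cong[OF \<open>open S\<close> deriv]) auto
  then show ?case using Suc.prems by auto
qed

lemma Ck_scaleR:
  fixes f :: "'e::euclidean_space \<Rightarrow> real"
  assumes "open S" "Ck k S f" "Ck k S g"
  shows "Ck k S (\<lambda>x. f x *\<^sub>R g x)"
  using assms(2-)
proof (induction k arbitrary: f g)
  case 0
  then show ?case by (auto intro: continuous_on_scaleR)
next
  case (Suc k)
  have deriv: "frechet_derivative (\<lambda>x. f x *\<^sub>R g x) (at x) v =
      f x *\<^sub>R frechet_derivative g (at x) v + frechet_derivative f (at x) v *\<^sub>R g x"
    if "x \<in> S" for x v
  proof -
    have "f differentiable (at x)" "g differentiable (at x)"
      using Suc.prems that by auto
    then show ?thesis
      by (subst frechet_derivative_at[symmetric, OF has_derivative_scaleR])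
         (auto simp: frechet_derivative_works)
  qed
  have "Ck k S (\<lambda>x. f x *\<^sub>R frechet_derivative g (at x) v + frechet_derivative f (at x) v *\<^sub>R g x)" for v
    using Suc Ck_SucD[OF Suc.prems(1)] Ck_SucD[OF Suc.prems(2)]
    by (auto intro!: Ck_add[OF \<open>open S\<close>])
  with deriv have "Ck k S (\<lambda>x. frechet_derivative (\<lambda>x. f x *\<^sub>R g x) (at x) v)" for v
    by (subst Ck_cong[OF \<open>open S\<close> deriv]) auto
  then show ?case using Suc.prems by auto
qed

lemma Ck_const: "Ck k S (\<lambda>x. c)"
  by (induction k arbitrary: c) auto

lemma smooth_on_const: "smooth_on S (\<lambda>x. c)"
  by (simp add: smooth_on_def Ck_const)

lemma smooth_on_add:
  "open S \<Longrightarrow> smooth_on S f \<Longrightarrow> smooth_on S g \<Longrightarrow> smooth_on S (\<lambda>x. f x + g x)"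
  by (simp add: smooth_on_def Ck_add)

lemma smooth_on_scaleR:
  fixes f :: "'e::euclidean_space \<Rightarrow> real"
  shows "open S \<Longrightarrow> smooth_on S f \<Longrightarrow> smooth_on S g \<Longrightarrow> smooth_on S (\<lambda>x. f x *\<^sub>R g x)"
  by (simp add: smooth_on_def Ck_scaleR)

lemma smooth_on_imp_differentiable:
  assumes "smooth_on S f" "x \<in> S"
  shows "f differentiable (at x)"
proof -
  have "Ck (Suc 0) S f" using assms(1) unfolding smooth_on_def by blast
  then show ?thesis using assms(2) by simp
qed

section \<open>Tangent spaces and the algebra of vector fields\<close>

lemma smooth_atlas_transition_linear:
  assumes "smooth_atlas A" "c \<in> charts_at A p" "d \<in> charts_at A p"
  shows "linear (frechet_derivative (local_rep c d id) (at (snd c p)))"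
proof (rule linear_frechet_derivative, rule smooth_on_imp_differentiable)
  show "smooth_on (snd c ` (fst c \<inter> fst d)) (local_rep c d id)"
    using assms by (auto simp: smooth_atlas_def charts_at_def)
  show "snd c p \<in> snd c ` (fst c \<inter> fst d)"
    using assms by (auto simp: charts_at_def)
qed

lemma smooth_atlas_charts_at_nonempty:
  assumes "smooth_atlas A"
  obtains c where "c \<in> charts_at A p"
  using assms unfolding smooth_atlas_def charts_at_def by blast

lemma smooth_atlas_open: "smooth_atlas A \<Longrightarrow> c \<in> A \<Longrightarrow> open (snd c ` fst c)"
  by (simp add: smooth_atlas_def is_chart_def)

text \<open>Jacobians of coordinate changes are linear, so the transformation law is a linear
  condition, as is vanishing off the charts around \<open>p\<close>.\<close>

lemma subspace_tangent_space:
  assumes "smooth_atlas A"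
  shows "subspace (tangent_space A p)"
proof -
  note lin = smooth_atlas_transition_linear[OF assms]
  have trans: "u d = frechet_derivative (local_rep c d id) (at (snd c p)) (u c)"
    if "u \<in> tangent_space A p" "c \<in> charts_at A p" "d \<in> charts_at A p" for u c d
    using that unfolding tangent_space_def by blast
  have outside: "u c = 0" if "u \<in> tangent_space A p" "c \<notin> charts_at A p" for u c
    using that unfolding tangent_space_def by blast
  show ?thesis
  proof (rule subspaceI)
    show "0 \<in> tangent_space A p"
      by (simp add: tangent_space_def linear_0[OF lin])
  next
    fix u v assume uv: "u \<in> tangent_space A p" "v \<in> tangent_space A p"
    have "(u + v) d = frechet_derivative (local_rep c d id) (at (snd c p)) ((u + v) c)"
      if "c \<in> charts_at A p" "d \<in> charts_at A p" for c d
      unfolding plus_fun_apply linear_add[OF lin[OF that]] trans[OF uv(1) that, symmetric]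
        trans[OF uv(2) that, symmetric] by (rule refl)
    moreover have "(u + v) c = 0" if "c \<notin> charts_at A p" for c
      using uv that by (simp add: outside)
    ultimately show "u + v \<in> tangent_space A p"
      unfolding tangent_space_def by blast
  next
    fix r u assume u: "u \<in> tangent_space A p"
    have "(r *\<^sub>R u) d = frechet_derivative (local_rep c d id) (at (snd c p)) ((r *\<^sub>R u) c)"
      if "c \<in> charts_at A p" "d \<in> charts_at A p" for c d
      unfolding scaleR_fun_apply linear_scale[OF lin[OF that]] trans[OF u that, symmetric]
      by (rule refl)
    moreover have "(r *\<^sub>R u) c = 0" if "c \<notin> charts_at A p" for c
      using u that by (simp add: outside)
    ultimately show "r *\<^sub>R u \<in> tangent_space A p"
      unfolding tangent_space_def by blast
  qed
qed

text \<open>The Jacobians carry the coordinates in one chart to all others around \<open>p\<close>,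
  and elsewhere both families vanish. This embeds the tangent space in the model space and bounds
  its dimension.\<close>

lemma tangent_space_eqI:
  assumes "u \<in> tangent_space A p" "v \<in> tangent_space A p" "c \<in> charts_at A p" "u c = v c"
  shows "u = v"
proof
  fix d
  show "u d = v d"
  proof (cases "d \<in> charts_at A p")
    case True
    have "w d = frechet_derivative (local_rep c d id) (at (snd c p)) (w c)"
      if "w \<in> tangent_space A p" for w
      using that assms(3) True unfolding tangent_space_def by blast
    then show ?thesis
      using assms(1,2,4) by metis
  next
    case False
    then have "w d = 0" if "w \<in> tangent_space A p" for w
      using that unfolding tangent_space_def by blast
    then show ?thesis
      using assms(1,2) by metis
  qed
qed

lemma vector_field_in_tangent_space: "vector_field A X \<Longrightarrow> X p \<in> tangent_space A p"
  by (simp add: vector_field_def)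

lemma vector_field_add:
  assumes "smooth_atlas A" "vector_field A X" "vector_field A Y"
  shows "vector_field A (X + Y)"
  unfolding vector_field_def
proof (intro conjI allI ballI)
  show "(X + Y) p \<in> tangent_space A p" for p
    using assms by (simp add: vector_field_def subspace_add subspace_tangent_space)
  fix c assume "c \<in> A"
  have "smooth_on (snd c ` fst c) (\<lambda>x. field_rep X c x + field_rep Y c x)"
    using assms \<open>c \<in> A\<close> by (intro smooth_on_add smooth_atlas_open) (auto simp: vector_field_def)
  then show "smooth_on (snd c ` fst c) (field_rep (X + Y) c)"
    by (simp add: field_rep_def)
qed

lemma vector_field_scaleR:
  assumes "smooth_atlas A" "smooth_fun A f" "vector_field A X"
  shows "vector_field A (\<lambda>p. f p *\<^sub>R X p)"
  unfolding vector_field_def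
proof (intro conjI allI ballI)
  show "f p *\<^sub>R X p \<in> tangent_space A p" for p
    using assms by (simp add: vector_field_def subspace_scale subspace_tangent_space)
  fix c assume "c \<in> A"
  have "smooth_on (snd c ` fst c)
      (\<lambda>x. (f \<circ> inv_into (fst c) (snd c)) x *\<^sub>R field_rep X c x)"
    using assms \<open>c \<in> A\<close>
    by (intro smooth_on_scaleR smooth_atlas_open) (auto simp: vector_field_def smooth_fun_def o_def)
  then show "smooth_on (snd c ` fst c) (field_rep (\<lambda>p. f p *\<^sub>R X p) c)"
    by (simp add: field_rep_def)
qed

lemma smooth_fun_const: "smooth_fun A (\<lambda>p. r)"
  by (simp add: smooth_fun_def o_def smooth_on_const)

lemma smooth_fun_scale:
  assumes "smooth_atlas A" "smooth_fun A f"
  shows "smooth_fun A (\<lambda>p. r * f p)"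
  unfolding smooth_fun_def
proof
  fix c assume "c \<in> A"
  have "smooth_on (snd c ` fst c) (\<lambda>x. r *\<^sub>R (f \<circ> inv_into (fst c) (snd c)) x)"
    using assms \<open>c \<in> A\<close>
    by (intro smooth_on_scaleR smooth_atlas_open smooth_on_const) (auto simp: smooth_fun_def o_def)
  then show "smooth_on (snd c ` fst c) ((\<lambda>p. r * f p) \<circ> inv_into (fst c) (snd c))"
    by (simp add: o_def)
qed

lemma vector_field_0: "smooth_atlas A \<Longrightarrow> vector_field A 0"
  by (simp add: vector_field_def field_rep_def smooth_on_const subspace_0 subspace_tangent_space)

lemma vector_field_sum:
  assumes "smooth_atlas A" "\<And>i. i \<in> I \<Longrightarrow> vector_field A (X i)"
  shows "vector_field A (\<Sum>i\<in>I. X i)"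
  using assms(2)
  by (induction I rule: infinite_finite_induct)
     (auto simp: vector_field_0[OF assms(1)] vector_field_add[OF assms(1)])

section \<open>Bilinear forms, tensors and connections\<close>

lemma tangent_space_sum:
  assumes "smooth_atlas A" "\<And>i. i \<in> I \<Longrightarrow> u i \<in> tangent_space A p"
  shows "(\<Sum>i\<in>I. a i *\<^sub>R u i) \<in> tangent_space A p"
  using assms by (intro subspace_sum subspace_scale subspace_tangent_space)

lemma pseudo_riemannianD:
  assumes "pseudo_riemannian A h"
  shows pseudo_riemannian_sym:
      "u \<in> tangent_space A p \<Longrightarrow> v \<in> tangent_space A p \<Longrightarrow> h p u v = h p v u"
    and pseudo_riemannian_add: "u \<in> tangent_space A p \<Longrightarrow> v \<in> tangent_space A p \<Longrightarrow>
      w \<in> tangent_space A p \<Longrightarrow> h p (u + v) w = h p u w + h p v w"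
    and pseudo_riemannian_scaleR: "u \<in> tangent_space A p \<Longrightarrow> v \<in> tangent_space A p \<Longrightarrow>
      h p (r *\<^sub>R u) v = r * h p u v"
    and pseudo_riemannian_nondegenerate: "u \<in> tangent_space A p \<Longrightarrow>
      (\<And>v. v \<in> tangent_space A p \<Longrightarrow> h p u v = 0) \<Longrightarrow> u = 0"
    and pseudo_riemannian_smooth: "vector_field A X \<Longrightarrow> vector_field A Y \<Longrightarrow>
      smooth_fun A (\<lambda>p. h p (X p) (Y p))"
proof -
  note h = assms[unfolded pseudo_riemannian_def]
  show "u \<in> tangent_space A p \<Longrightarrow> v \<in> tangent_space A p \<Longrightarrow> h p u v = h p v u"
    using h[THEN conjunct1] by blast
  show "u \<in> tangent_space A p \<Longrightarrow> v \<in> tangent_space A p \<Longrightarrow>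
      w \<in> tangent_space A p \<Longrightarrow> h p (u + v) w = h p u w + h p v w"
    using h[THEN conjunct2, THEN conjunct1] by blast
  show "u \<in> tangent_space A p \<Longrightarrow> v \<in> tangent_space A p \<Longrightarrow> h p (r *\<^sub>R u) v = r * h p u v"
    using h[THEN conjunct2, THEN conjunct2, THEN conjunct1] by blast
  show "u \<in> tangent_space A p \<Longrightarrow> (\<And>v. v \<in> tangent_space A p \<Longrightarrow> h p u v = 0) \<Longrightarrow> u = 0"
    using h[THEN conjunct2, THEN conjunct2, THEN conjunct2, THEN conjunct1] by blast
  show "vector_field A X \<Longrightarrow> vector_field A Y \<Longrightarrow> smooth_fun A (\<lambda>p. h p (X p) (Y p))"
    using h[THEN conjunct2, THEN conjunct2, THEN conjunct2, THEN conjunct2] by blast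
qed

lemma pseudo_riemannian_sum_left:
  assumes "smooth_atlas A" "pseudo_riemannian A h"
    and "\<And>i. i \<in> I \<Longrightarrow> u i \<in> tangent_space A p" "w \<in> tangent_space A p"
  shows "h p (\<Sum>i\<in>I. a i *\<^sub>R u i) w = (\<Sum>i\<in>I. a i * h p (u i) w)"
  using assms(3)
proof (induction I rule: infinite_finite_induct)
  case (insert i I)
  have "h p (a i *\<^sub>R u i + (\<Sum>i\<in>I. a i *\<^sub>R u i)) w =
      h p (a i *\<^sub>R u i) w + h p (\<Sum>i\<in>I. a i *\<^sub>R u i) w"
    using insert.prems assms
    by (intro pseudo_riemannian_add tangent_space_sum subspace_scale subspace_tangent_space) auto
  moreover have "h p (a i *\<^sub>R u i) w = a i * h p (u i) w"
    using insert.prems assms by (intro pseudo_riemannian_scaleR) auto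
  moreover have "h p (\<Sum>i\<in>I. a i *\<^sub>R u i) w = (\<Sum>i\<in>I. a i * h p (u i) w)"
    using insert by blast
  ultimately show ?case
    unfolding sum.insert[OF insert.hyps] by linarith
qed (use pseudo_riemannian_scaleR[OF assms(2), of 0 p w 0] assms(4)
      subspace_0[OF subspace_tangent_space[OF assms(1)]] in simp_all)

lemma pseudo_riemannian_sum_sum:
  assumes "smooth_atlas A" "pseudo_riemannian A h"
    and u: "\<And>i. i \<in> I \<Longrightarrow> u i \<in> tangent_space A p" and v: "\<And>j. j \<in> K \<Longrightarrow> v j \<in> tangent_space A p"
  shows "h p (\<Sum>i\<in>I. a i *\<^sub>R u i) (\<Sum>j\<in>K. b j *\<^sub>R v j) =
    (\<Sum>i\<in>I. \<Sum>j\<in>K. a i * b j * h p (u i) (v j))"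
proof -
  have "h p (u i) (\<Sum>j\<in>K. b j *\<^sub>R v j) = (\<Sum>j\<in>K. b j * h p (u i) (v j))" if "i \<in> I" for i
  proof -
    have "h p (u i) (\<Sum>j\<in>K. b j *\<^sub>R v j) = h p (\<Sum>j\<in>K. b j *\<^sub>R v j) (u i)"
      using assms that by (intro pseudo_riemannian_sym tangent_space_sum) auto
    also have "\<dots> = (\<Sum>j\<in>K. b j * h p (v j) (u i))"
      using assms that by (intro pseudo_riemannian_sum_left) auto
    also have "\<dots> = (\<Sum>j\<in>K. b j * h p (u i) (v j))"
      using assms(2) u v that by (intro sum.cong refl arg_cong2[of _ _ _ _ "(*)"] pseudo_riemannian_sym) auto
    finally show ?thesis .
  qed
  moreover have "h p (\<Sum>i\<in>I. a i *\<^sub>R u i) (\<Sum>j\<in>K. b j *\<^sub>R v j) =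
      (\<Sum>i\<in>I. a i * h p (u i) (\<Sum>j\<in>K. b j *\<^sub>R v j))"
    using assms by (intro pseudo_riemannian_sum_left tangent_space_sum) auto
  ultimately show ?thesis
    by (simp add: sum_distrib_left mult.assoc)
qed

text \<open>Linearity over the ring of smooth functions, the property that makes an operator on
  fields act pointwise. It is asked of smooth fields only, because \<open>affine_connection\<close>
  constrains \<open>D\<close> on these alone.\<close>

definition tensorial ::
  "('a, 'e::euclidean_space) chart set \<Rightarrow> (('a, 'e) vfield \<Rightarrow> ('a, 'e) vfield) \<Rightarrow> bool" where
  "tensorial A F \<longleftrightarrow>
     (\<forall>X Y. vector_field A X \<and> vector_field A Y \<longrightarrow> F (X + Y) = F X + F Y) \<and>
     (\<forall>f X. smooth_fun A f \<and> vector_field A X \<longrightarrow>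
        F (\<lambda>p. f p *\<^sub>R X p) = (\<lambda>p. f p *\<^sub>R F X p))"

lemma tensorial_sum:
  assumes "smooth_atlas A" "tensorial A F" "\<And>i. i \<in> I \<Longrightarrow> vector_field A (V i)"
  shows "F (\<Sum>i\<in>I. V i) = (\<Sum>i\<in>I. F (V i))"
proof -
  \<comment> \<open>Homogeneity for the zero function yields \<open>F 0 = 0\<close>, the case of the
    empty sum.\<close>
  have "F (\<lambda>p. 0 *\<^sub>R (0 :: 'a \<Rightarrow> _) p) = (\<lambda>p. 0 *\<^sub>R F 0 p)"
    using assms(2) vector_field_0[OF assms(1)] smooth_fun_const[of A 0]
    unfolding tensorial_def by blast
  then have F0: "F 0 = 0" by (simp add: zero_fun_def)
  show ?thesis
    using assms(3)
  proof (induction I rule: infinite_finite_induct)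
    case (insert i I)
    then have "F (V i + (\<Sum>i\<in>I. V i)) = F (V i) + F (\<Sum>i\<in>I. V i)"
      using assms(1,2) vector_field_sum[OF assms(1), of I V] unfolding tensorial_def by auto
    moreover have "F (\<Sum>i\<in>I. V i) = (\<Sum>i\<in>I. F (V i))"
      using insert by blast
    ultimately show ?case
      unfolding sum.insert[OF insert.hyps] by metis
  qed (simp_all add: F0)
qed

lemma sum_fun_apply: "(\<Sum>i\<in>I. f i) x = (\<Sum>i\<in>I. f i x)"
  for f :: "'i \<Rightarrow> 'a \<Rightarrow> 'b::comm_monoid_add"
  by (induction I rule: infinite_finite_induct) auto

lemma almost_complexD:
  assumes "almost_complex A J"
  shows almost_complex_closed: "u \<in> tangent_space A p \<Longrightarrow> J p u \<in> tangent_space A p"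
    and almost_complex_add: "u \<in> tangent_space A p \<Longrightarrow> v \<in> tangent_space A p \<Longrightarrow>
      J p (u + v) = J p u + J p v"
    and almost_complex_scaleR: "u \<in> tangent_space A p \<Longrightarrow> J p (r *\<^sub>R u) = r *\<^sub>R J p u"
    and almost_complex_square: "u \<in> tangent_space A p \<Longrightarrow> J p (J p u) = - u"
    and almost_complex_vector_field: "vector_field A X \<Longrightarrow> vector_field A (\<lambda>p. J p (X p))"
proof -
  note J = assms[unfolded almost_complex_def]
  show "u \<in> tangent_space A p \<Longrightarrow> J p u \<in> tangent_space A p"
    using J[THEN conjunct1] by blast
  show "u \<in> tangent_space A p \<Longrightarrow> v \<in> tangent_space A p \<Longrightarrow> J p (u + v) = J p u + J p v"
    using J[THEN conjunct2, THEN conjunct1] by blast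
  show "u \<in> tangent_space A p \<Longrightarrow> J p (r *\<^sub>R u) = r *\<^sub>R J p u"
    using J[THEN conjunct2, THEN conjunct2, THEN conjunct1] by blast
  show "u \<in> tangent_space A p \<Longrightarrow> J p (J p u) = - u"
    using J[THEN conjunct2, THEN conjunct2, THEN conjunct2, THEN conjunct1] by blast
  show "vector_field A X \<Longrightarrow> vector_field A (\<lambda>p. J p (X p))"
    using J[THEN conjunct2, THEN conjunct2, THEN conjunct2, THEN conjunct2] by blast
qed

lemma affine_connectionD:
  assumes "affine_connection A D"
  shows affine_connection_vector_field:
      "vector_field A X \<Longrightarrow> vector_field A Y \<Longrightarrow> vector_field A (D X Y)"
    and affine_connection_add_left:
      "vector_field A X \<Longrightarrow> vector_field A X' \<Longrightarrow> vector_field A Y \<Longrightarrow> D (X + X') Y = D X Y + D X' Y"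
    and affine_connection_scale_left:
      "smooth_fun A f \<Longrightarrow> vector_field A X \<Longrightarrow> vector_field A Y \<Longrightarrow>
        D (\<lambda>p. f p *\<^sub>R X p) Y = (\<lambda>p. f p *\<^sub>R D X Y p)"
    and affine_connection_add_right:
      "vector_field A X \<Longrightarrow> vector_field A Y \<Longrightarrow> vector_field A Y' \<Longrightarrow> D X (Y + Y') = D X Y + D X Y'"
    and affine_connection_scale_right:
      "smooth_fun A f \<Longrightarrow> vector_field A X \<Longrightarrow> vector_field A Y \<Longrightarrow>
        D X (\<lambda>p. f p *\<^sub>R Y p) = (\<lambda>p. dir_deriv A X f p *\<^sub>R Y p + f p *\<^sub>R D X Y p)"
proof -
  note D = assms[unfolded affine_connection_def]
  show "vector_field A X \<Longrightarrow> vector_field A Y \<Longrightarrow> vector_field A (D X Y)"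
    using D[THEN conjunct1] by blast
  show "vector_field A X \<Longrightarrow> vector_field A X' \<Longrightarrow> vector_field A Y \<Longrightarrow> D (X + X') Y = D X Y + D X' Y"
    using D[THEN conjunct2, THEN conjunct1] by blast
  show "smooth_fun A f \<Longrightarrow> vector_field A X \<Longrightarrow> vector_field A Y \<Longrightarrow>
      D (\<lambda>p. f p *\<^sub>R X p) Y = (\<lambda>p. f p *\<^sub>R D X Y p)"
    using D[THEN conjunct2, THEN conjunct2, THEN conjunct1] by blast
  show "vector_field A X \<Longrightarrow> vector_field A Y \<Longrightarrow> vector_field A Y' \<Longrightarrow> D X (Y + Y') = D X Y + D X Y'"
    using D[THEN conjunct2, THEN conjunct2, THEN conjunct2, THEN conjunct1] by blast
  show "smooth_fun A f \<Longrightarrow> vector_field A X \<Longrightarrow> vector_field A Y \<Longrightarrow>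
      D X (\<lambda>p. f p *\<^sub>R Y p) = (\<lambda>p. dir_deriv A X f p *\<^sub>R Y p + f p *\<^sub>R D X Y p)"
    using D[THEN conjunct2, THEN conjunct2, THEN conjunct2, THEN conjunct2] by blast
qed

text \<open>In the direction slot both terms of (D_U J) Z are already function-linear. In the other
  slot, D_Z (J (f U)) and J (D_Z (f U)) produce the same Leibniz term (Z f) J U, which cancels in
  the difference.\<close>

lemma tensorial_cov_deriv_endo:
  assumes A: "smooth_atlas A" and D: "affine_connection A D" and J: "almost_complex A J"
    and Z: "vector_field A Z"
  shows tensorial_cov_deriv_endo_left: "tensorial A (\<lambda>U. cov_deriv_endo D J U Z)" (is ?left)
    and tensorial_cov_deriv_endo_right: "tensorial A (cov_deriv_endo D J Z)" (is ?right)
proof -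
  note JZ = almost_complex_vector_field[OF J Z]
  have T: "D U V p \<in> tangent_space A p" if "vector_field A U" "vector_field A V" for U V p
    using that by (intro vector_field_in_tangent_space affine_connection_vector_field[OF D])
  note subspace = subspace_scale[OF subspace_tangent_space[OF A]]
  show ?left
    unfolding tensorial_def
  proof (intro conjI allI impI; elim conjE)
    fix U V assume U: "vector_field A U" and V: "vector_field A V"
    show "cov_deriv_endo D J (U + V) Z = cov_deriv_endo D J U Z + cov_deriv_endo D J V Z"
      unfolding cov_deriv_endo_def affine_connection_add_left[OF D U V Z]
        affine_connection_add_left[OF D U V JZ] plus_fun_apply
        almost_complex_add[OF J T[OF U Z] T[OF V Z]]
      by (simp add: fun_eq_iff)
  next
    fix f U assume f: "smooth_fun A f" and U: "vector_field A U"
    show "cov_deriv_endo D J (\<lambda>p. f p *\<^sub>R U p) Z = (\<lambda>p. f p *\<^sub>R cov_deriv_endo D J U Z p)"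
      unfolding cov_deriv_endo_def affine_connection_scale_left[OF D f U Z]
        affine_connection_scale_left[OF D f U JZ] almost_complex_scaleR[OF J T[OF U Z]]
      by (simp add: scaleR_diff_right)
  qed
  show ?right
    unfolding tensorial_def
  proof (intro conjI allI impI; elim conjE)
    fix U V assume U: "vector_field A U" and V: "vector_field A V"
    note T' = vector_field_in_tangent_space[OF U] vector_field_in_tangent_space[OF V]
    have "(\<lambda>q. J q ((U + V) q)) = (\<lambda>q. J q (U q)) + (\<lambda>q. J q (V q))"
      unfolding plus_fun_apply almost_complex_add[OF J T'] by (simp add: plus_fun_def)
    then show "cov_deriv_endo D J Z (U + V) = cov_deriv_endo D J Z U + cov_deriv_endo D J Z V"
      unfolding cov_deriv_endo_def affine_connection_add_right[OF D Z U V]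
      using affine_connection_add_right[OF D Z almost_complex_vector_field[OF J U]
          almost_complex_vector_field[OF J V]]
        almost_complex_add[OF J T[OF Z U] T[OF Z V]]
      by (simp add: plus_fun_def fun_diff_def algebra_simps)
  next
    fix f U assume f: "smooth_fun A f" and U: "vector_field A U"
    note T' = vector_field_in_tangent_space[OF U]
    have "(\<lambda>q. J q (f q *\<^sub>R U q)) = (\<lambda>q. f q *\<^sub>R J q (U q))"
      unfolding almost_complex_scaleR[OF J T'] ..
    moreover have "J p (dir_deriv A Z f p *\<^sub>R U p + f p *\<^sub>R D Z U p) =
        dir_deriv A Z f p *\<^sub>R J p (U p) + f p *\<^sub>R J p (D Z U p)" for p
      using almost_complex_add[OF J subspace[OF T'] subspace[OF T[OF Z U]]]
        almost_complex_scaleR[OF J T'] almost_complex_scaleR[OF J T[OF Z U]] by metis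
    ultimately show "cov_deriv_endo D J Z (\<lambda>p. f p *\<^sub>R U p) = (\<lambda>p. f p *\<^sub>R cov_deriv_endo D J Z U p)"
      unfolding cov_deriv_endo_def
      using affine_connection_scale_right[OF D f Z U]
        affine_connection_scale_right[OF D f Z almost_complex_vector_field[OF J U]]
      by (simp add: scaleR_diff_right)
  qed
qed

lemma cov_deriv_endo_in_tangent_space:
  assumes "smooth_atlas A" "affine_connection A D" "almost_complex A J"
    "vector_field A U" "vector_field A V"
  shows "cov_deriv_endo D J U V p \<in> tangent_space A p"
proof -
  have T: "D U W p \<in> tangent_space A p" if "vector_field A W" for W
    by (rule vector_field_in_tangent_space[OF affine_connection_vector_field[OF assms(2,4) that]])
  show ?thesis
    unfolding cov_deriv_endo_def
    by (rule subspace_diff[OF subspace_tangent_space[OF assms(1)]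
          T[OF almost_complex_vector_field[OF assms(3,5)]]
          almost_complex_closed[OF assms(3) T[OF assms(5)]]])
qed

section \<open>Orthogonal frames\<close>

text \<open>\<open>matrix_inv\<close> is a choice of a two-sided inverse. For square matrices a
  right inverse is two-sided, and two-sided inverses are unique.\<close>

lemma matrix_inv_eqI:
  fixes M N :: "'a::field^'n^'n"
  assumes "M ** N = mat 1"
  shows "matrix_inv M = N"
proof -
  have "N ** M = mat 1"
    using assms by (simp add: matrix_left_right_inverse)
  with assms have "M ** matrix_inv M = mat 1 \<and> matrix_inv M ** M = mat 1"
    unfolding matrix_inv_def
    by (intro someI[where P = "\<lambda>B. M ** B = mat 1 \<and> B ** M = mat 1"]) simp
  then have "(matrix_inv M ** M) ** N = N" by simp
  then show ?thesis
    by (simp add: matrix_mul_assoc[symmetric] assms)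
qed

lemma sum_swap_pairs:
  "(\<Sum>i\<in>I. \<Sum>j\<in>J. \<Sum>k\<in>K. \<Sum>l\<in>L. f i j k l) = (\<Sum>k\<in>K. \<Sum>l\<in>L. \<Sum>i\<in>I. \<Sum>j\<in>J. f i j k l)"
proof -
  have "(\<Sum>i\<in>I. \<Sum>j\<in>J. \<Sum>k\<in>K. \<Sum>l\<in>L. f i j k l) = (\<Sum>i\<in>I. \<Sum>k\<in>K. \<Sum>j\<in>J. \<Sum>l\<in>L. f i j k l)"
    by (intro sum.cong refl sum.swap)
  also have "\<dots> = (\<Sum>k\<in>K. \<Sum>i\<in>I. \<Sum>j\<in>J. \<Sum>l\<in>L. f i j k l)"
    by (rule sum.swap)
  also have "\<dots> = (\<Sum>k\<in>K. \<Sum>i\<in>I. \<Sum>l\<in>L. \<Sum>j\<in>J. f i j k l)"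
    by (intro sum.cong refl sum.swap)
  also have "\<dots> = (\<Sum>k\<in>K. \<Sum>l\<in>L. \<Sum>i\<in>I. \<Sum>j\<in>J. f i j k l)"
    by (intro sum.cong refl sum.swap)
  finally show ?thesis .
qed

text \<open>The constants \<epsilon> may have either sign, as \<open>g\<close> is indefinite; being
  independent of the point, they do not affect smoothness of coordinates. Frame and model space
  share the index type \<open>'n\<close>, so there are as many fields as dimensions.\<close>

locale orthogonal_frame =
  fixes A :: "('a::{t2_space,second_countable_topology}, real^'n) chart set"
    and g :: "('a, real^'n) bilin_field"
    and X :: "'n \<Rightarrow> ('a, real^'n) vfield"
    and \<epsilon> :: "'n \<Rightarrow> real"
  assumes atlas: "smooth_atlas A"
    and metric: "pseudo_riemannian A g"
    and frame: "\<And>i. vector_field A (X i)"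
    and orthogonal: "\<And>p i j. g p (X i p) (X j p) = (if i = j then \<epsilon> i else 0)"
    and nonzero: "\<And>i. \<epsilon> i \<noteq> 0"
begin

definition coord :: "'a \<Rightarrow> ('a, real^'n) tvec \<Rightarrow> 'n \<Rightarrow> real" where
  "coord p u i = g p u (X i p) / \<epsilon> i"

lemma frame_in_tangent_space: "X i p \<in> tangent_space A p"
  by (rule vector_field_in_tangent_space[OF frame])

lemma coord_sum:
  assumes "\<And>k. k \<in> I \<Longrightarrow> u k \<in> tangent_space A p"
  shows "coord p (\<Sum>k\<in>I. a k *\<^sub>R u k) j = (\<Sum>k\<in>I. a k * coord p (u k) j)"
  using assms
  by (simp add: coord_def pseudo_riemannian_sum_left[OF atlas metric] frame_in_tangent_space
      sum_divide_distrib)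

lemma coord_frame: "coord p (X i p) j = (if i = j then 1 else 0)"
  by (simp add: coord_def orthogonal nonzero)

lemma coord_sum_frame: "coord p (\<Sum>i\<in>UNIV. a i *\<^sub>R X i p) j = a j"
  by (simp add: coord_sum frame_in_tangent_space coord_frame if_distrib[of "\<lambda>x. _ * x"]
      cong: if_cong)

text \<open>A dimension count: in a chart, combining the frame vectors is a linear map from
  \<open>real^'n\<close> to itself. Orthogonality with nonzero \<epsilon> makes it injective, hence
  surjective.\<close>

lemma frame_expansion:
  assumes "u \<in> tangent_space A p"
  shows "u = (\<Sum>i\<in>UNIV. coord p u i *\<^sub>R X i p)"
proof -
  obtain c where c: "c \<in> charts_at A p"
    using smooth_atlas_charts_at_nonempty[OF atlas] .
  define L where "L = (\<lambda>a::real^'n. (\<Sum>i\<in>UNIV. (a $ i) *\<^sub>R X i p) c)"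
  have "linear L"
    by (rule linearI) (simp_all add: L_def sum_fun_apply scaleR_left_distrib sum.distrib
        scaleR_sum_right)
  moreover have "a = 0" if "L a = 0" for a
  proof -
    have "(\<Sum>i\<in>UNIV. (a $ i) *\<^sub>R X i p) = (0 :: ('a, real^'n) tvec)"
    proof (rule tangent_space_eqI[OF _ _ c])
      show "(\<Sum>i\<in>UNIV. (a $ i) *\<^sub>R X i p) \<in> tangent_space A p"
        by (rule tangent_space_sum[OF atlas frame_in_tangent_space])
      show "0 \<in> tangent_space A p"
        by (rule subspace_0[OF subspace_tangent_space[OF atlas]])
    qed (use that in \<open>simp add: L_def\<close>)
    then have "a $ j = coord p 0 j" for j
      using coord_sum_frame[of p "\<lambda>i. a $ i" j] by simp
    moreover have "coord p 0 j = 0" for j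
      using coord_sum_frame[of p "\<lambda>i. 0" j] by simp
    ultimately show ?thesis by (simp add: vec_eq_iff)
  qed
  ultimately have "surj L"
    by (intro linear_injective_imp_surjective) (simp_all add: linear_injective_0)
  then obtain a where "L a = u c" by (metis surjD)
  then have "u = (\<Sum>i\<in>UNIV. (a $ i) *\<^sub>R X i p)"
    unfolding L_def
    by (intro tangent_space_eqI[OF assms _ c] tangent_space_sum[OF atlas frame_in_tangent_space])
      simp
  then show ?thesis
    using coord_sum_frame[of p "\<lambda>i. a $ i"] by simp
qed

lemma basis_of_frame: "basis_of (tangent_space A p) (\<lambda>i. X i p)"
  unfolding basis_of_def
proof (intro conjI)
  show inj: "inj (\<lambda>i. X i p)"
    by (rule injI) (metis coord_frame zero_neq_one)
  show "independent (range (\<lambda>i. X i p))"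
  proof (rule independent_if_scalars_zero)
    fix f u assume "(\<Sum>x\<in>range (\<lambda>i. X i p). f x *\<^sub>R x) = 0" "u \<in> range (\<lambda>i. X i p)"
    then obtain j where j: "u = X j p" and "(\<Sum>i\<in>UNIV. f (X i p) *\<^sub>R X i p) = 0"
      by (auto simp: sum.reindex[OF inj])
    then have "f (X j p) = coord p 0 j"
      using coord_sum_frame[of p "\<lambda>i. f (X i p)" j] by simp
    also have "\<dots> = 0"
      using coord_sum_frame[of p "\<lambda>i. 0" j] by simp
    finally show "f u = 0" using j by simp
  qed simp
  show "span (range (\<lambda>i. X i p)) = tangent_space A p"
  proof
    show "span (range (\<lambda>i. X i p)) \<subseteq> tangent_space A p"
      by (intro span_minimal subspace_tangent_space atlas) (auto simp: frame_in_tangent_space)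
    show "tangent_space A p \<subseteq> span (range (\<lambda>i. X i p))"
    proof
      fix u assume "u \<in> tangent_space A p"
      then have "u = (\<Sum>i\<in>UNIV. coord p u i *\<^sub>R X i p)" by (rule frame_expansion)
      moreover have "\<dots> \<in> span (range (\<lambda>i. X i p))"
        by (intro span_sum span_scale span_base) simp
      ultimately show "u \<in> span (range (\<lambda>i. X i p))" by metis
    qed
  qed
qed

lemma smooth_coord:
  assumes "vector_field A U"
  shows "smooth_fun A (\<lambda>p. coord p (U p) i)"
  using smooth_fun_scale[OF atlas pseudo_riemannian_smooth[OF metric assms frame], of "1 / \<epsilon> i" i]
  by (simp add: coord_def)

text \<open>The field \<open>U\<close> is expanded globally, with smooth coefficient functions that
  \<open>F\<close> lets through. Hence \<open>F U p\<close> depends on \<open>U\<close> only through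
  \<open>U p\<close>.\<close>

lemma tensorial_frame_expansion:
  assumes "tensorial A F" "vector_field A U"
  shows "F U p = (\<Sum>i\<in>UNIV. coord p (U p) i *\<^sub>R F (X i) p)"
proof -
  have "U = (\<Sum>i\<in>UNIV. (\<lambda>p. coord p (U p) i *\<^sub>R X i p))"
  proof
    fix p
    show "U p = (\<Sum>i\<in>UNIV. (\<lambda>p. coord p (U p) i *\<^sub>R X i p)) p"
      unfolding sum_fun_apply[where x = p]
      by (intro frame_expansion vector_field_in_tangent_space assms)
  qed
  then have "F U = F (\<Sum>i\<in>UNIV. (\<lambda>p. coord p (U p) i *\<^sub>R X i p))" by (rule arg_cong)
  also have "\<dots> = (\<Sum>i\<in>UNIV. F (\<lambda>p. coord p (U p) i *\<^sub>R X i p))"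
    by (intro tensorial_sum[OF atlas assms(1)] vector_field_scaleR atlas smooth_coord assms frame)
  also have "\<dots> = (\<Sum>i\<in>UNIV. (\<lambda>p. coord p (U p) i *\<^sub>R F (X i) p))"
    using assms(1) smooth_coord[OF assms(2)] frame
    by (intro sum.cong refl) (simp add: tensorial_def)
  finally show ?thesis by (simp add: sum_fun_apply)
qed

text \<open>The choice in \<open>extension\<close> is well-founded: freezing the coordinates of
  \<open>u\<close> at \<open>p\<close> gives a global field through \<open>u\<close> with constant
  coefficients.\<close>

lemma extension:
  assumes "u \<in> tangent_space A p"
  shows "vector_field A (extension A p u)" "extension A p u p = u"
proof -
  have "vector_field A (\<Sum>i\<in>UNIV. (\<lambda>q. coord p u i *\<^sub>R X i q))"
    by (intro vector_field_sum vector_field_scaleR smooth_fun_const atlas frame)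
  moreover have "(\<Sum>i\<in>UNIV. (\<lambda>q. coord p u i *\<^sub>R X i q)) p = u"
    unfolding sum_fun_apply[where x = p] by (rule frame_expansion[OF assms, symmetric])
  ultimately have "vector_field A (\<Sum>i\<in>UNIV. (\<lambda>q. coord p u i *\<^sub>R X i q)) \<and>
      (\<Sum>i\<in>UNIV. (\<lambda>q. coord p u i *\<^sub>R X i q)) p = u" ..
  then have "vector_field A (extension A p u) \<and> extension A p u p = u"
    unfolding extension_def by (rule someI[where P = "\<lambda>U. vector_field A U \<and> U p = u"])
  then show "vector_field A (extension A p u)" "extension A p u p = u" by auto
qed

text \<open>Tensoriality in both slots leaves only the values of the chosen extensions at
  \<open>p\<close>, which are \<open>u\<close> and \<open>v\<close>.\<close>

lemma cov_deriv_endo_at_frame: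
  assumes "affine_connection A D" "almost_complex A J"
    and u: "u \<in> tangent_space A p" and v: "v \<in> tangent_space A p"
  shows "cov_deriv_endo_at A D J p u v =
    (\<Sum>i\<in>UNIV. \<Sum>j\<in>UNIV. (coord p u i * coord p v j) *\<^sub>R cov_deriv_endo D J (X i) (X j) p)"
proof -
  note u' = extension[OF u] and v' = extension[OF v]
  show ?thesis
    unfolding cov_deriv_endo_at_def
    using tensorial_frame_expansion[OF tensorial_cov_deriv_endo_left[OF atlas assms(1,2) v'(1)] u'(1), of p]
      tensorial_frame_expansion[OF tensorial_cov_deriv_endo_right[OF atlas assms(1,2) frame] v'(1), of _ p]
      u'(2) v'(2)
    by (simp add: scaleR_sum_right)
qed

section \<open>Contraction of the square norm in a frame\<close>

text \<open>With \<open>P\<close> the matrix of \<open>e\<close> in the frame and \<open>Q\<close> its inverse, the Gram matrix of \<open>e\<close> is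
  \<open>P H P\<^sup>T\<close>, whose inverse is \<open>Q\<^sup>T M Q\<close>.\<close>

lemma contraction_basis_independent:
  fixes e :: "'n \<Rightarrow> ('a, real^'n) tvec"
  assumes h: "pseudo_riemannian A h"
    and M: "(\<chi> i j. h p (X i p) (X j p)) ** M = mat 1"
    and e: "basis_of (tangent_space A p) e"
  shows "(\<Sum>i\<in>UNIV. \<Sum>j\<in>UNIV. inverse_gram h p e $ i $ j * coord p (e i) a * coord p (e j) b) =
    M $ a $ b"
proof -
  have inj: "inj e" and span: "span (range e) = tangent_space A p"
    using e by (auto simp: basis_of_def)
  have eT: "e i \<in> tangent_space A p" for i
    using span_base[of "e i" "range e"] span by auto
  define P where "P = (\<chi> i a. coord p (e i) a)"
  define H where "H = (\<chi> i j. h p (X i p) (X j p))"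
  have "\<exists>q. X a p = (\<Sum>i\<in>UNIV. q i *\<^sub>R e i)" for a
  proof -
    have "X a p \<in> span (range e)"
      using span frame_in_tangent_space by blast
    then obtain q where "X a p = (\<Sum>v\<in>range e. q v *\<^sub>R v)"
      by (auto simp: span_finite)
    then have "X a p = (\<Sum>i\<in>UNIV. q (e i) *\<^sub>R e i)"
      by (simp add: sum.reindex[OF inj])
    then show ?thesis by (rule exI[of _ "\<lambda>i. q (e i)"])
  qed
  then obtain q where q: "X a p = (\<Sum>i\<in>UNIV. q a i *\<^sub>R e i)" for a
    by metis
  define Q where "Q = (\<chi> a i. q a i)"
  have QP: "Q ** P = mat 1"
  proof -
    have "(Q ** P) $ a $ b = coord p (\<Sum>i\<in>UNIV. q a i *\<^sub>R e i) b" for a b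
      using coord_sum[of UNIV e p "q a" b] eT by (simp add: matrix_matrix_mult_def Q_def P_def)
    then show ?thesis
      by (simp add: q[symmetric] coord_frame vec_eq_iff mat_def)
  qed
  \<comment> \<open>A basis is indexed by \<open>'n\<close> as the frame is, so both matrices are
    square and a one-sided inverse suffices.\<close>
  then have PQ: "P ** Q = mat 1"
    by (simp add: matrix_left_right_inverse)
  have "h p (e i) (e j) = (P ** H ** transpose P) $ i $ j" for i j
  proof -
    have "h p (e i) (e j) = h p (\<Sum>a\<in>UNIV. coord p (e i) a *\<^sub>R X a p) (\<Sum>b\<in>UNIV. coord p (e j) b *\<^sub>R X b p)"
      using frame_expansion[OF eT[of i]] frame_expansion[OF eT[of j]] by metis
    also have "\<dots> = (\<Sum>a\<in>UNIV. \<Sum>b\<in>UNIV. coord p (e i) a * coord p (e j) b * h p (X a p) (X b p))"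
      by (rule pseudo_riemannian_sum_sum[OF atlas h frame_in_tangent_space frame_in_tangent_space])
    also have "\<dots> = (P ** H ** transpose P) $ i $ j"
      unfolding matrix_matrix_mult_def transpose_def P_def H_def
      by (subst sum.swap) (simp add: sum_distrib_left sum_distrib_right mult_ac)
    finally show ?thesis .
  qed
  then have gram: "(\<chi> i j. h p (e i) (e j)) = P ** H ** transpose P"
    by (simp add: vec_eq_iff)
  have QPT: "transpose P ** transpose Q = mat 1"
    by (simp add: QP flip: matrix_transpose_mul)
  have "(P ** H ** transpose P) ** (transpose Q ** M ** Q) =
      P ** (H ** ((transpose P ** transpose Q) ** M)) ** Q"
    by (simp only: matrix_mul_assoc)
  also have "\<dots> = mat 1"
    using M by (simp add: QPT PQ H_def)
  finally have inv: "inverse_gram h p e = transpose Q ** M ** Q"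
    unfolding inverse_gram_def gram by (rule matrix_inv_eqI)
  have "(\<Sum>i\<in>UNIV. \<Sum>j\<in>UNIV. inverse_gram h p e $ i $ j * coord p (e i) a * coord p (e j) b) =
      (transpose P ** (transpose Q ** M ** Q) ** P) $ a $ b"
    unfolding inv[symmetric] unfolding matrix_matrix_mult_def transpose_def P_def
    by (subst sum.swap) (simp add: sum_distrib_left sum_distrib_right mult_ac)
  also have "transpose P ** (transpose Q ** M ** Q) ** P = (transpose P ** transpose Q) ** M ** (Q ** P)"
    by (simp only: matrix_mul_assoc)
  finally show ?thesis by (simp add: QPT QP)
qed

text \<open>Leaving \<beta> arbitrary allows nested use: the entries of the outer form may
  themselves be contractions.\<close>

lemma contraction_bilinear:
  fixes e :: "'n \<Rightarrow> ('a, real^'n) tvec" and \<beta> :: "'n \<Rightarrow> 'n \<Rightarrow> real"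
  assumes "pseudo_riemannian A h" "(\<chi> i j. h p (X i p) (X j p)) ** M = mat 1"
    and "basis_of (tangent_space A p) e"
  shows "(\<Sum>i\<in>UNIV. \<Sum>j\<in>UNIV. inverse_gram h p e $ i $ j *
      (\<Sum>a\<in>UNIV. \<Sum>b\<in>UNIV. coord p (e i) a * coord p (e j) b * \<beta> a b)) =
    (\<Sum>a\<in>UNIV. \<Sum>b\<in>UNIV. M $ a $ b * \<beta> a b)"
proof -
  let ?t = "\<lambda>i j a b. inverse_gram h p e $ i $ j * coord p (e i) a * coord p (e j) b * \<beta> a b"
  have "(\<Sum>i\<in>UNIV. \<Sum>j\<in>UNIV. inverse_gram h p e $ i $ j *
      (\<Sum>a\<in>UNIV. \<Sum>b\<in>UNIV. coord p (e i) a * coord p (e j) b * \<beta> a b)) =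
      (\<Sum>i\<in>UNIV. \<Sum>j\<in>UNIV. \<Sum>a\<in>UNIV. \<Sum>b\<in>UNIV. ?t i j a b)"
    by (simp add: sum_distrib_left mult.assoc)
  also have "\<dots> = (\<Sum>a\<in>UNIV. \<Sum>b\<in>UNIV. \<Sum>i\<in>UNIV. \<Sum>j\<in>UNIV. ?t i j a b)"
    by (rule sum_swap_pairs)
  finally show ?thesis
    by (simp add: contraction_basis_independent[OF assms, symmetric] sum_distrib_right)
qed

lemma square_norm_nabla_J_frame:
  fixes e :: "'n \<Rightarrow> ('a, real^'n) tvec"
  assumes D: "affine_connection A D" and J: "almost_complex A J"
    and h: "pseudo_riemannian A h"
    and M: "(\<chi> i j. h p (X i p) (X j p)) ** M = mat 1"
    and e: "basis_of (tangent_space A p) e"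
  shows "square_norm_nabla_J A J h D p e =
    (\<Sum>a\<in>UNIV. \<Sum>b\<in>UNIV. M $ a $ b * (\<Sum>c\<in>UNIV. \<Sum>d\<in>UNIV. M $ c $ d *
      h p (cov_deriv_endo D J (X a) (X c) p) (cov_deriv_endo D J (X b) (X d) p)))"
proof -
  define N where "N a c = cov_deriv_endo D J (X a) (X c) p" for a c
  define \<Phi> where "\<Phi> a b c d = h p (N a c) (N b d)" for a b c d
  have NT: "N a c \<in> tangent_space A p" for a c
    unfolding N_def by (rule cov_deriv_endo_in_tangent_space[OF atlas D J frame frame])
  have eT: "e i \<in> tangent_space A p" for i
    using span_base[of "e i" "range e"] e by (auto simp: basis_of_def)
  have \<Phi>: "h p (cov_deriv_endo_at A D J p (e i) (e k)) (cov_deriv_endo_at A D J p (e j) (e l)) =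
      (\<Sum>a\<in>UNIV. \<Sum>b\<in>UNIV. coord p (e i) a * coord p (e j) b *
        (\<Sum>c\<in>UNIV. \<Sum>d\<in>UNIV. coord p (e k) c * coord p (e l) d * \<Phi> a b c d))" for i j k l
  proof -
    have "cov_deriv_endo_at A D J p (e i) (e k) =
        (\<Sum>a\<in>UNIV. coord p (e i) a *\<^sub>R (\<Sum>c\<in>UNIV. coord p (e k) c *\<^sub>R N a c))" for i k
      unfolding cov_deriv_endo_at_frame[OF D J eT eT] N_def by (simp add: scaleR_sum_right)
    then show ?thesis
      unfolding \<Phi>_def
      by (simp only: pseudo_riemannian_sum_sum[OF atlas h] NT tangent_space_sum[OF atlas])
  qed
  \<comment> \<open>The contraction over k, l is moved inside the one over i, j, so that each
    becomes an instance of the bilinear contraction formula.\<close>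
  have "square_norm_nabla_J A J h D p e =
      (\<Sum>i\<in>UNIV. \<Sum>j\<in>UNIV. inverse_gram h p e $ i $ j *
        (\<Sum>a\<in>UNIV. \<Sum>b\<in>UNIV. coord p (e i) a * coord p (e j) b *
          (\<Sum>k\<in>UNIV. \<Sum>l\<in>UNIV. inverse_gram h p e $ k $ l *
            (\<Sum>c\<in>UNIV. \<Sum>d\<in>UNIV. coord p (e k) c * coord p (e l) d * \<Phi> a b c d))))"
  proof -
    have "(\<Sum>k\<in>UNIV. \<Sum>l\<in>UNIV. G i j * G k l * (\<Sum>a\<in>UNIV. \<Sum>b\<in>UNIV. x i j a b * y k l a b)) =
        G i j * (\<Sum>a\<in>UNIV. \<Sum>b\<in>UNIV. x i j a b * (\<Sum>k\<in>UNIV. \<Sum>l\<in>UNIV. G k l * y k l a b))"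
      for i j and G :: "'n \<Rightarrow> 'n \<Rightarrow> real" and x y :: "'n \<Rightarrow> 'n \<Rightarrow> 'n \<Rightarrow> 'n \<Rightarrow> real"
      unfolding sum_distrib_left
      by (subst sum_swap_pairs) (simp add: mult_ac)
    then show ?thesis
      unfolding square_norm_nabla_J_def \<Phi>
      by (intro sum.cong refl)
  qed
  then show ?thesis
    unfolding contraction_bilinear[OF h M e] by (simp add: \<Phi>_def N_def)
qed

end

section \<open>Twin metric and Koszul formula\<close>

text \<open>\<open>J\<close> is self-adjoint for \<open>g\<close>: g(u, Jv) = - g(Ju, JJv) = g(Ju,
  v), which is the symmetry of the twin. Nondegeneracy is inherited because every v is J applied to
  -Jv.\<close>

lemma twin_norden_metric:
  assumes A: "smooth_atlas A" and J: "almost_complex A J" and g: "norden_metric A J g"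
  shows "norden_metric A J (\<lambda>p u v. g p u (J p v))"
proof -
  have pr: "pseudo_riemannian A g"
    using g by (simp add: norden_metric_def)
  have norden: "g p (J p u) (J p v) = - g p u v"
    if "u \<in> tangent_space A p" "v \<in> tangent_space A p" for p u v
    using g that unfolding norden_metric_def by blast
  note J_closed = almost_complex_closed[OF J] and J_vf = almost_complex_vector_field[OF J]
  have JJ: "g p u (J p (J p v)) = - g p u v"
    if u: "u \<in> tangent_space A p" and v: "v \<in> tangent_space A p" for p u v
  proof -
    have "g p u (J p (J p v)) = g p (- v) u"
      using pseudo_riemannian_sym[OF pr u J_closed[OF J_closed[OF v]]] almost_complex_square[OF J v]
      by simp
    also have "\<dots> = - g p u v"
      using pseudo_riemannian_scaleR[OF pr v u, of "-1"] pseudo_riemannian_sym[OF pr u v] by simp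
    finally show ?thesis .
  qed
  have "pseudo_riemannian A (\<lambda>p u v. g p u (J p v))"
    unfolding pseudo_riemannian_def
  proof (intro conjI allI ballI impI; (elim conjE)?)
    fix p u v assume u: "u \<in> tangent_space A p" and v: "v \<in> tangent_space A p"
    have "g p u (J p v) = - g p (J p u) (J p (J p v))"
      using norden[OF u J_closed[OF v]] by simp
    also have "\<dots> = g p (J p u) v"
      using JJ[OF J_closed[OF u] v] by simp
    finally show "g p u (J p v) = g p v (J p u)"
      using pseudo_riemannian_sym[OF pr v J_closed[OF u]] by simp
  next
    fix p u v w
    assume "u \<in> tangent_space A p" "v \<in> tangent_space A p" "w \<in> tangent_space A p"
    then show "g p (u + v) (J p w) = g p u (J p w) + g p v (J p w)"
      by (intro pseudo_riemannian_add[OF pr] J_closed)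
  next
    fix p u v r assume "u \<in> tangent_space A p" "v \<in> tangent_space A p"
    then show "g p (r *\<^sub>R u) (J p v) = r * g p u (J p v)"
      by (intro pseudo_riemannian_scaleR[OF pr] J_closed)
  next
    fix p u assume u: "u \<in> tangent_space A p" and 0: "\<forall>v\<in>tangent_space A p. g p u (J p v) = 0"
    show "u = 0"
    proof (rule pseudo_riemannian_nondegenerate[OF pr u])
      fix v assume v: "v \<in> tangent_space A p"
      show "g p u v = 0"
        using 0 J_closed[OF v] JJ[OF u v] by simp
    qed
  next
    fix U V assume "vector_field A U" "vector_field A V"
    then show "smooth_fun A (\<lambda>p. g p (U p) (J p (V p)))"
      by (rule pseudo_riemannian_smooth[OF pr _ J_vf])
  qed
  moreover have "g p (J p u) (J p (J p v)) = - g p u (J p v)"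
    if "u \<in> tangent_space A p" "v \<in> tangent_space A p" for p u v
    using norden[OF that(1) J_closed[OF that(2)]] .
  ultimately show ?thesis
    unfolding norden_metric_def by blast
qed

lemma almost_complex_sum:
  assumes "smooth_atlas A" "almost_complex A J" "\<And>i. i \<in> I \<Longrightarrow> u i \<in> tangent_space A p"
  shows "J p (\<Sum>i\<in>I. a i *\<^sub>R u i) = (\<Sum>i\<in>I. a i *\<^sub>R J p (u i))"
  using assms(3)
proof (induction I rule: infinite_finite_induct)
  case (insert i I)
  have "J p (a i *\<^sub>R u i + (\<Sum>i\<in>I. a i *\<^sub>R u i)) =
      J p (a i *\<^sub>R u i) + J p (\<Sum>i\<in>I. a i *\<^sub>R u i)"
    using insert.prems assms
    by (intro almost_complex_add tangent_space_sum subspace_scale subspace_tangent_space) auto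
  moreover have "J p (a i *\<^sub>R u i) = a i *\<^sub>R J p (u i)"
    using insert.prems assms(2) by (intro almost_complex_scaleR) auto
  moreover have "J p (\<Sum>i\<in>I. a i *\<^sub>R u i) = (\<Sum>i\<in>I. a i *\<^sub>R J p (u i))"
    using insert by blast
  ultimately show ?case
    unfolding sum.insert[OF insert.hyps] by metis
qed (use almost_complex_scaleR[OF assms(2), of 0 p 0] subspace_0[OF subspace_tangent_space[OF assms(1)]]
      in simp_all)

lemma dir_deriv_const: "dir_deriv A X (\<lambda>p. r) p = 0"
  by (simp add: dir_deriv_def o_def)

lemma levi_civitaD:
  assumes "levi_civita A h D"
  shows levi_civita_affine: "affine_connection A D"
    and levi_civita_torsion_free: "vector_field A X \<Longrightarrow> vector_field A Y \<Longrightarrow>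
      D X Y - D Y X = lie_bracket A X Y"
    and levi_civita_metric: "vector_field A X \<Longrightarrow> vector_field A Y \<Longrightarrow> vector_field A Z \<Longrightarrow>
      dir_deriv A X (\<lambda>q. h q (Y q) (Z q)) p = h p (D X Y p) (Z p) + h p (Y p) (D X Z p)"
  using assms unfolding levi_civita_def by blast+

text \<open>The products \<open>h(X_i, X_j)\<close> are constant, so the derivative terms of the
  general Koszul formula vanish and metric compatibility says that
  \<open>h(D_{X_i} X_j, X_k)\<close> is skew in j and k.\<close>

lemma koszul_constant:
  assumes A: "smooth_atlas A" and h: "pseudo_riemannian A h" and D: "levi_civita A h D"
    and X: "\<And>i. vector_field A (X i)" and const: "\<And>i j p. h p (X i p) (X j p) = H i j"
  shows "2 * h p (D (X i) (X j) p) (X k p) =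
    h p (lie_bracket A (X i) (X j) p) (X k p) - h p (lie_bracket A (X j) (X k) p) (X i p)
      + h p (lie_bracket A (X k) (X i) p) (X j p)"
proof -
  have T: "D (X i) (X j) p \<in> tangent_space A p" "X i p \<in> tangent_space A p" for i j
    using X by (auto intro!: vector_field_in_tangent_space
        affine_connection_vector_field[OF levi_civita_affine[OF D]])
  have skew: "h p (D (X i) (X j) p) (X k p) + h p (D (X i) (X k) p) (X j p) = 0" for i j k
    using levi_civita_metric[OF D X[of i] X[of j] X[of k], of p]
      pseudo_riemannian_sym[OF h T(2)[of j] T(1)[of i k]]
    by (simp add: const dir_deriv_const)
  have bracket: "h p (lie_bracket A (X i) (X j) p) (X k p) =
      h p (D (X i) (X j) p) (X k p) - h p (D (X j) (X i) p) (X k p)" for i j k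
  proof -
    have "D (X i) (X j) p = lie_bracket A (X i) (X j) p + D (X j) (X i) p"
      using levi_civita_torsion_free[OF D X[of i] X[of j]] by (auto simp: fun_eq_iff algebra_simps)
    \<comment> \<open>Torsion-freeness writes the bracket as a difference of tangent vectors; this
      replaces a computation with second derivatives of coordinate changes.\<close>
    moreover have "lie_bracket A (X i) (X j) p \<in> tangent_space A p"
      unfolding levi_civita_torsion_free[OF D X X, symmetric] fun_diff_def
      using subspace_diff[OF subspace_tangent_space[OF A] T(1)[of i j] T(1)[of j i]]
      by (simp add: fun_diff_def)
    ultimately show ?thesis
      using pseudo_riemannian_add[OF h _ T(1)[of j i] T(2)[of k]] by simp
  qed
  show ?thesis
    \<comment> \<open>The three brackets become six connection terms. Skewness cancels four of them
      in pairs and equates the other two.\<close>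
    unfolding bracket using skew[of i j k] skew[of j i k] skew[of k i j] by simp
qed

section \<open>The Lie algebra of the proposition\<close>

text \<open>The index notation below encodes \<open>J X\<^sub>i = sgn4 i X\<^bsub>mate i\<^esub>\<close> and \<open>g(X\<^sub>i, X\<^sub>i) = sgn4 i\<close>.\<close>

definition mate :: "4 \<Rightarrow> 4" where
  "mate i = (if i = 1 then 3 else if i = 2 then 4 else if i = 3 then 1 else 2)"

definition sgn4 :: "4 \<Rightarrow> real" where
  "sgn4 i = (if i = 1 \<or> i = 2 then 1 else -1)"

lemma mate_simps [simp]: "mate 1 = 3" "mate 2 = 4" "mate 3 = 1" "mate 4 = 2"
  by (simp_all add: mate_def)

lemma sgn4_simps [simp]: "sgn4 1 = 1" "sgn4 2 = 1" "sgn4 3 = -1" "sgn4 4 = -1"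
  by (simp_all add: sgn4_def)

text \<open>Here \<open>C i j k\<close>, \<open>\<Gamma> i j k\<close> and \<open>F i j k\<close> stand for \<open>gt\<close> of \<open>[X\<^sub>i, X\<^sub>j]\<close>, of \<open>D\<^bsub>X\<^sub>i\<^esub> X\<^sub>j\<close> and of
  \<open>(D\<^bsub>X\<^sub>i\<^esub> J) X\<^sub>j\<close> with \<open>X\<^sub>k\<close>, and \<open>H\<close> is the Gram matrix of \<open>gt\<close>.\<close>

lemma structure_constants_square_norm:
  fixes C \<Gamma> F :: "4 \<Rightarrow> 4 \<Rightarrow> 4 \<Rightarrow> real" and l1 l2 l3 l4 :: real
  defines "H \<equiv> \<lambda>i j. if i = mate j then -1 else 0"
  assumes C: "\<And>k. C 1 3 k = l2 * H 2 k + l4 * H 4 k"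
    "\<And>k. C 2 4 k = l1 * H 1 k + l3 * H 3 k"
    "\<And>k. C 2 3 k = - l2 * H 1 k - l3 * H 4 k"
    "\<And>k. C 3 4 k = - l4 * H 1 k + l3 * H 2 k"
    "\<And>k. C 4 1 k = l1 * H 2 k + l4 * H 3 k"
    "\<And>k. C 2 1 k = - l2 * H 3 k + l1 * H 4 k"
    and skew: "\<And>i j k. C j i k = - C i j k"
    and \<Gamma>: "\<And>i j k. 2 * \<Gamma> i j k = C i j k - C j k i + C k i j"
    and F: "\<And>i j k. F i j k = sgn4 j * \<Gamma> i (mate j) k - sgn4 k * \<Gamma> i j (mate k)"
  shows "(\<Sum>i\<in>UNIV. \<Sum>j\<in>UNIV. \<Sum>k\<in>UNIV. F i j (mate k) * F (mate i) (mate j) k) =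
    8 * (l1 * l3 + l2 * l4)"
proof -
  have C_diag: "C i i k = 0" for i k
    using skew[of i i k] by simp
  \<comment> \<open>The bracket table lists one order of each pair of indices; these are the
    opposite ones.\<close>
  have C_swap: "C 3 1 k = - C 1 3 k" "C 4 2 k = - C 2 4 k" "C 3 2 k = - C 2 3 k" "C 4 3 k = - C 3 4 k"
     "C 1 4 k = - C 4 1 k" "C 1 2 k = - C 2 1 k" for k
    by (rule skew)+
  have \<Gamma>_eq: "\<Gamma> i j k = (C i j k - C j k i + C k i j) / 2" for i j k
    using \<Gamma>[of i j k] by simp
  show ?thesis
    \<comment> \<open>Every entry of \<open>C\<close> is now explicit, so the 64-term sum is a
      polynomial identity in the parameters.\<close>
    unfolding sum_4 F \<Gamma>_eq mate_simps sgn4_simps C_diag C_swap C H_def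
    by (simp add: algebra_simps)
qed

theorem proposition3p3:
  fixes l1 l2 l3 l4 :: real
    and G :: "'a::{t2_space,second_countable_topology} monoid"
    and A :: "('a, real^4) chart set"
    and X :: "4 \<Rightarrow> ('a, real^4) vfield"
    and J :: "('a, real^4) endo_field"
    and g gt :: "('a, real^4) bilin_field"
    and D :: "('a, real^4) connection"
  assumes "lie_group G A"
    and "connected (UNIV :: 'a set)"
    and "basis_of (left_invariant_fields G A) X"
    and "lie_bracket A (X 1) (X 3) = l2 *\<^sub>R X 2 + l4 *\<^sub>R X 4"
    and "lie_bracket A (X 2) (X 4) = l1 *\<^sub>R X 1 + l3 *\<^sub>R X 3"
    and "lie_bracket A (X 2) (X 3) = - l2 *\<^sub>R X 1 - l3 *\<^sub>R X 4"
    and "lie_bracket A (X 3) (X 4) = - l4 *\<^sub>R X 1 + l3 *\<^sub>R X 2"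
    and "lie_bracket A (X 4) (X 1) = l1 *\<^sub>R X 2 + l4 *\<^sub>R X 3"
    and "lie_bracket A (X 2) (X 1) = - l2 *\<^sub>R X 3 + l1 *\<^sub>R X 4"
    and "almost_complex A J" and "left_invariant_endo G A J"
    and "\<And>p. J p (X 1 p) = X 3 p"
    and "\<And>p. J p (X 2 p) = X 4 p"
    and "\<And>p. J p (X 3 p) = - X 1 p"
    and "\<And>p. J p (X 4 p) = - X 2 p"
    and "left_invariant_metric G A g"
    and "\<And>p. g p (X 1 p) (X 1 p) = 1"
    and "\<And>p. g p (X 2 p) (X 2 p) = 1"
    and "\<And>p. g p (X 3 p) (X 3 p) = -1"
    and "\<And>p. g p (X 4 p) (X 4 p) = -1"
    and "\<And>p i j. i \<noteq> j \<Longrightarrow> g p (X i p) (X j p) = 0"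
    and "\<And>p u v. gt p u v = g p u (J p v)"
    and "levi_civita A gt D"
  shows "isotropic_kaehler_norden A J gt D \<longleftrightarrow> l1 * l3 + l2 * l4 = 0"
proof -
  have A: "smooth_atlas A"
    using assms(1) by (simp add: lie_group_def)
  have g: "pseudo_riemannian A g"
    using assms(16) by (simp add: left_invariant_metric_def)
  note J = \<open>almost_complex A J\<close> and D = \<open>levi_civita A gt D\<close>
  note D_affine = levi_civita_affine[OF D]
  have X: "vector_field A (X i)" for i
    using assms(3) span_base[of "X i" "range X"]
    by (auto simp: basis_of_def left_invariant_fields_def)
  have "\<forall>i. g p (X i p) (X i p) = sgn4 i" for p
    unfolding forall_4 using assms(17-20) by simp
  then have orth: "g p (X i p) (X j p) = (if i = j then sgn4 i else 0)" for p i j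
    using assms(21) by simp
  interpret orthogonal_frame A g X sgn4
    by unfold_locales (auto simp: A g X orth sgn4_def)
  note XT = frame_in_tangent_space
  have "\<forall>i. J p (X i p) = sgn4 i *\<^sub>R X (mate i) p" for p
    unfolding forall_4 using assms(12-15) by simp
  then have JX: "J p (X i p) = sgn4 i *\<^sub>R X (mate i) p" for p i ..
  have g_right: "g p u (r *\<^sub>R v) = r * g p u v"
    if "u \<in> tangent_space A p" "v \<in> tangent_space A p" for p u v r
    using pseudo_riemannian_sym[OF g] pseudo_riemannian_scaleR[OF g] that
      subspace_scale[OF subspace_tangent_space[OF A]] by metis
  \<comment> \<open>\<open>J\<close> and \<open>g\<close> are prescribed on the frame only; the
    Norden identity is checked there and extended by bilinearity.\<close>
  have g_norden: "norden_metric A J g"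
    unfolding norden_metric_def
  proof (intro conjI allI ballI g)
    fix p u v assume u: "u \<in> tangent_space A p" and v: "v \<in> tangent_space A p"
    have *: "g p (J p (X i p)) (J p (X j p)) = - g p (X i p) (X j p)" for i j
    proof -
      have "g p (J p (X i p)) (J p (X j p)) = sgn4 i * sgn4 j * g p (X (mate i) p) (X (mate j) p)"
        unfolding JX
        using pseudo_riemannian_scaleR[OF g XT subspace_scale[OF subspace_tangent_space[OF A] XT]]
        by (simp add: g_right[OF XT XT])
      \<comment> \<open>For i = j the sign product is 1 and partners have opposite
        \<open>g\<close>-norms; for distinct indices the partners are distinct too and both sides
        vanish.\<close>
      also have "\<dots> = - g p (X i p) (X j p)"
        using exhaust_4[of i] exhaust_4[of j] by (auto simp: orth)
      finally show ?thesis .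
    qed
    have "g p (J p u) (J p v) =
        g p (J p (\<Sum>i\<in>UNIV. coord p u i *\<^sub>R X i p)) (J p (\<Sum>j\<in>UNIV. coord p v j *\<^sub>R X j p))"
      using frame_expansion[OF u] frame_expansion[OF v] by metis
    also have "\<dots> = - g p (\<Sum>i\<in>UNIV. coord p u i *\<^sub>R X i p) (\<Sum>j\<in>UNIV. coord p v j *\<^sub>R X j p)"
      unfolding almost_complex_sum[OF A J XT]
      by (simp only: pseudo_riemannian_sum_sum[OF A g] XT almost_complex_closed[OF J] *
          mult_minus_right sum_negf)
    also have "\<dots> = - g p u v"
      using frame_expansion[OF u] frame_expansion[OF v] by metis
    finally show "g p (J p u) (J p v) = - g p u v" .
  qed
  have gt_eq: "gt = (\<lambda>p u v. g p u (J p v))"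
    using assms(22) by blast
  have gt_norden: "norden_metric A J gt"
    unfolding gt_eq by (rule twin_norden_metric[OF A J g_norden])
  then have gt: "pseudo_riemannian A gt"
    by (simp add: norden_metric_def)
  define H where "H i j = (if i = mate j then -1 else 0 :: real)" for i j
  have gt_frame: "gt p u (X j p) = sgn4 j * g p u (X (mate j) p)" if "u \<in> tangent_space A p" for p u j
    unfolding gt_eq JX by (rule g_right[OF that XT])
  have gtX: "gt p (X i p) (X j p) = H i j" for p i j
    unfolding gt_frame[OF XT] orth H_def using exhaust_4[of i] exhaust_4[of j] by auto
  have gtJ: "gt p (J p u) (X k p) = sgn4 k * gt p u (X (mate k) p)"
    if u: "u \<in> tangent_space A p" for p u k
  proof -
    have "gt p (J p u) (X k p) = - g p u (X k p)"
      using g_norden u XT unfolding norden_metric_def gt_eq by blast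
    \<comment> \<open>Passing to the partner index flips \<open>sgn4\<close>, which accounts for the
      minus sign.\<close>
    also have "\<dots> = sgn4 k * gt p u (X (mate k) p)"
      unfolding gt_frame[OF u] using exhaust_4[of k] by auto
    finally show ?thesis .
  qed
  \<comment> \<open>With respect to \<open>gt\<close>, the frame dual to \<open>X k\<close> consists
    of the fields \<open>- X (mate k)\<close>.\<close>
  have gt_expand: "gt p u w = - (\<Sum>k\<in>UNIV. gt p u (X (mate k) p) * gt p w (X k p))"
    if u: "u \<in> tangent_space A p" and w: "w \<in> tangent_space A p" for p u w
  proof -
    have coord: "coord p u k = - gt p u (X (mate k) p)" for k
      unfolding coord_def gt_frame[OF u] using exhaust_4[of k] by auto
    have "gt p u w = gt p (\<Sum>k\<in>UNIV. coord p u k *\<^sub>R X k p) w"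
      using frame_expansion[OF u] by simp
    also have "\<dots> = (\<Sum>k\<in>UNIV. coord p u k * gt p (X k p) w)"
      by (rule pseudo_riemannian_sum_left[OF A gt XT w])
    finally show ?thesis
      by (simp add: coord pseudo_riemannian_sym[OF gt XT w] sum_negf)
  qed
  have norm: "square_norm_nabla_J A J gt D p e = - 8 * (l1 * l3 + l2 * l4)"
    if e: "basis_of (tangent_space A p) e"
    for p and e :: "4 \<Rightarrow> ('a, real^4) tvec"
  proof -
    define N where "N i j = cov_deriv_endo D J (X i) (X j) p" for i j
    define C where "C i j k = gt p (lie_bracket A (X i) (X j) p) (X k p)" for i j k
    define \<Gamma> where "\<Gamma> i j k = gt p (D (X i) (X j) p) (X k p)" for i j k
    define F where "F i j k = gt p (N i j) (X k p)" for i j k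
    have NT: "N i j \<in> tangent_space A p" for i j
      unfolding N_def by (rule cov_deriv_endo_in_tangent_space[OF A D_affine J X X])
    have DT: "D (X i) (X j) p \<in> tangent_space A p" for i j
      by (intro vector_field_in_tangent_space affine_connection_vector_field[OF D_affine] X)
    have lin: "gt p ((a *\<^sub>R X i + b *\<^sub>R X j) p) (X k p) = a * H i k + b * H j k" for a b i j k
      using pseudo_riemannian_add[OF gt subspace_scale[OF subspace_tangent_space[OF A] XT]
          subspace_scale[OF subspace_tangent_space[OF A] XT] XT]
        pseudo_riemannian_scaleR[OF gt XT XT]
      unfolding plus_fun_apply[of "a *\<^sub>R X i"] scaleR_fun_apply[of _ "X i"]
        scaleR_fun_apply[of _ "X j"]
      by (simp only: gtX)
    have lin': "gt p ((a *\<^sub>R X i - b *\<^sub>R X j) p) (X k p) = a * H i k - b * H j k" for a b i j k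
      using lin[of a i "- b" j k] by simp
    have C: "C 1 3 k = l2 * H 2 k + l4 * H 4 k"
        "C 2 4 k = l1 * H 1 k + l3 * H 3 k"
        "C 2 3 k = - l2 * H 1 k - l3 * H 4 k"
        "C 3 4 k = - l4 * H 1 k + l3 * H 2 k"
        "C 4 1 k = l1 * H 2 k + l4 * H 3 k"
        "C 2 1 k = - l2 * H 3 k + l1 * H 4 k" for k
      unfolding C_def assms(4-9)
      by (rule lin lin')+
    have skew: "C j i k = - C i j k" for i j k
    proof -
      have "lie_bracket A (X j) (X i) p = (-1) *\<^sub>R lie_bracket A (X i) (X j) p"
        by (simp add: lie_bracket_def fun_eq_iff)
      moreover have "lie_bracket A (X i) (X j) p \<in> tangent_space A p"
        using subspace_diff[OF subspace_tangent_space[OF A] DT[of i j] DT[of j i]]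
        unfolding levi_civita_torsion_free[OF D X X, symmetric] by (simp add: fun_diff_def)
      ultimately show ?thesis
        unfolding C_def using pseudo_riemannian_scaleR[OF gt _ XT, of _ p "-1"] by simp
    qed
    have \<Gamma>: "2 * \<Gamma> i j k = C i j k - C j k i + C k i j" for i j k
      unfolding \<Gamma>_def C_def by (rule koszul_constant[OF A gt D X gtX])
    have F: "F i j k = sgn4 j * \<Gamma> i (mate j) k - sgn4 k * \<Gamma> i j (mate k)" for i j k
    proof -
      \<comment> \<open>\<open>J\<close> maps frame fields to constant multiples of frame fields, so
        no Leibniz term arises. The minus sign is written as a scaling by -1, since metrics are
        given as additive and homogeneous.\<close>
      have "N i j = sgn4 j *\<^sub>R D (X i) (X (mate j)) p + (-1) *\<^sub>R J p (D (X i) (X j) p)"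
        unfolding N_def cov_deriv_endo_def JX
        using affine_connection_scale_right[OF D_affine smooth_fun_const X X]
        by (simp add: dir_deriv_const)
      then show ?thesis
        unfolding F_def \<Gamma>_def
        using pseudo_riemannian_add[OF gt subspace_scale[OF subspace_tangent_space[OF A] DT]
            subspace_scale[OF subspace_tangent_space[OF A] almost_complex_closed[OF J DT]] XT]
          pseudo_riemannian_scaleR[OF gt DT XT]
          pseudo_riemannian_scaleR[OF gt almost_complex_closed[OF J DT] XT]
        by (simp only: gtJ[OF DT])
    qed
    have "(\<chi> i j. gt p (X i p) (X j p)) ** (\<chi> i j. H i j) = mat 1"
      unfolding gtX by (simp add: vec_eq_iff forall_4 matrix_matrix_mult_def sum_4 mat_def H_def)
    from square_norm_nabla_J_frame[OF D_affine J gt this e]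
    have "square_norm_nabla_J A J gt D p e =
        (\<Sum>a\<in>UNIV. \<Sum>b\<in>UNIV. H a b * (\<Sum>c\<in>UNIV. \<Sum>d\<in>UNIV. H c d * gt p (N a c) (N b d)))"
      by (simp add: N_def)
    \<comment> \<open>Each factor \<open>H\<close> is -1 at partner indices and 0 elsewhere, so the
      two signs cancel here; the expansion of \<open>gt\<close> below contributes the remaining
      one.\<close>
    also have "\<dots> = (\<Sum>i\<in>UNIV. \<Sum>j\<in>UNIV. gt p (N i j) (N (mate i) (mate j)))"
      by (simp add: sum_4 H_def)
    also have "\<dots> = - (\<Sum>i\<in>UNIV. \<Sum>j\<in>UNIV. \<Sum>k\<in>UNIV. F i j (mate k) * F (mate i) (mate j) k)"
      by (simp only: gt_expand[OF NT NT] F_def sum_negf)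
    also have "\<dots> = - 8 * (l1 * l3 + l2 * l4)"
      using structure_constants_square_norm[OF C[unfolded H_def] skew \<Gamma> F] by simp
    finally show ?thesis .
  qed
  show ?thesis
  proof
    assume "isotropic_kaehler_norden A J gt D"
    \<comment> \<open>The norm is constant, so an arbitrary point with the frame as its basis
      decides.\<close>
    then have "square_norm_nabla_J A J gt D undefined (\<lambda>i. X i undefined) = 0"
      using basis_of_frame unfolding isotropic_kaehler_norden_def by blast
    then show "l1 * l3 + l2 * l4 = 0"
      unfolding norm[OF basis_of_frame] by simp
  next
    assume "l1 * l3 + l2 * l4 = 0"
    then show "isotropic_kaehler_norden A J gt D"
      unfolding isotropic_kaehler_norden_def using J gt_norden D norm by simp
  qed
qed

end
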